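(* For any given $x\in(0,\infty)$, as $n\to\infty$, $$\mathrm{MSE}(\hat F_{n,b}^{\mathrm{Gam}}(x)) = \mathrm{Var}(\hat F_{n,b}^{\mathrm{Gam}}(x))+\big(\mathrm{Bias}[\hat F_{n,b}^{\mathrm{Gam}}(x)]\big)^2$$ $$= n^{-1}F(x)(1-F(x)) - n^{-1}b^{1/2}\cdot\frac{\sqrt{x}\,f(x)}{\sqrt{\pi}} + b^2\cdot\Big(f(x)+\frac{x}{2}f'(x)\Big)^2+O_x(n^{-1}b)+o_x(b^2).$$ In particular, if $f(x)\cdot(f(x)+\frac{x}{2}f'(x))\neq0$, the asymptotically optimal choice of $b$, with respect to $\mathrm{MSE}$, is $$b_{\mathrm{opt}} = n^{-2/3}\left[\frac{4\cdot(f(x)+\frac{x}{2}f'(x))^2}{\sqrt{x}\,f(x)/\sqrt{\pi}}\right]^{-2/3},$$ with $$\mathrm{MSE}(\hat F_{n,b_{\mathrm{opt}}}^{\mathrm{Gam}}(x)) = n^{-1}F(x)(1-F(x)) - n^{-4/3}\,\frac34\left[\frac{(\sqrt{x}\,f(x)/\sqrt{\pi})^4}{4\cdot(f(x)+\frac{x}{2}f'(x))^2}\right]^{1/3}+o_x(n^{-4/3}).$$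
   Context: $F$ is a cumulative distribution function supported on $[0,\infty)$ having two continuous and bounded derivatives; $f=F'$. $X_1,X_2,\dots$ are i.i.d. with c.d.f. $F$. The smoothing parameter $b=b_n>0$ satisfies $b\to0$ as $n\to\infty$. The Gamma kernel c.d.f. estimator is $$\hat F_{n,b}^{\mathrm{Gam}}(x):=\frac1n\sum_{i=1}^n\overline K_{\mathrm{Gam}}(X_i\mid b^{-1}x+1,\,b),\qquad \overline K_{\mathrm{Gam}}(t\mid\alpha,\theta):=\frac{\Gamma(\alpha,t/\theta)}{\Gamma(\alpha)},\quad \alpha,\theta>0,$$ where $\Gamma(\alpha,z):=\int_z^\infty t^{\alpha-1}e^{-t}\,dt$ and $\Gamma(\alpha):=\Gamma(\alpha,0)$. For an estimator $\hat F$, $\mathrm{Bias}[\hat F(x)]:=\mathbb{E}[\hat F(x)]-F(x)$ and $\mathrm{MSE}(\hat F(x)):=\mathbb{E}[(\hat F(x)-F(x))^2]$. "Asymptotically optimal choice of $b$ with respect to MSE" means the minimizer over $b>0$ of the expansion of the MSE with the error terms $O_x(n^{-1}b)$ and $o_x(b^2)$ dropped. Notation: $u=O(v)$ means $\limsup|u/v|<C<\infty$ as $n\to\infty$, where $C$ may depend on $F$ but on no other variable unless written as a subscript ($O_x$ allows dependence on $x$); $u=o(v)$ means $\lim|u/v|=0$ as $n\to\infty$, with the same rule for subscripts. *)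

theory Defs
  imports "HOL-Probability.Probability" "HOL-Library.Landau_Symbols"
begin

definition upper_Gamma :: "real \<Rightarrow> real \<Rightarrow> real" where
  "upper_Gamma \<alpha> z = (LBINT t:{z..}. t powr (\<alpha> - 1) * exp (- t))"

text \<open>In particular, the library's \<open>Gamma\<close> is the complete integral.\<close>

lemma upper_Gamma_0:
  assumes "\<alpha> > 0"
  shows "upper_Gamma \<alpha> 0 = Gamma \<alpha>"
proof -
  have "((\<lambda>t. t powr (\<alpha> - 1) / exp t) has_integral Gamma \<alpha>) {0..}"
    using Gamma_integral_real[OF assms] .
  hence hk: "((\<lambda>t. indicator {0..} t *\<^sub>R (t powr (\<alpha> - 1) * exp (- t))) has_integral Gamma \<alpha>) UNIV"
    by (subst (asm) has_integral_restrict_UNIV [symmetric], elim has_integral_eq[rotated])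
       (auto simp: indicator_def exp_minus field_simps)
  have "((\<lambda>t. indicator {0..} t *\<^sub>R (t powr (\<alpha> - 1) * exp (- t))) has_integral
          integral\<^sup>L lborel (\<lambda>t. indicator {0..} t *\<^sub>R (t powr (\<alpha> - 1) * exp (- t)))) UNIV"
  proof (rule has_integral_integral_lborel, rule integrableI_nonneg)
    show "(\<integral>\<^sup>+ t. ennreal (indicator {0..} t *\<^sub>R (t powr (\<alpha> - 1) * exp (- t))) \<partial>lborel) < \<infinity>"
      by (subst nn_integral_has_integral_lborel[OF _ _ hk]) auto
  qed auto
  thus ?thesis
    using has_integral_unique[OF hk] by (simp add: upper_Gamma_def set_lebesgue_integral_def)
qed

text \<open>Survival function at \<open>t\<close> of the Gamma distribution with shape \<open>\<alpha>\<close> and scale \<open>\<theta>\<close>.\<close>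

definition Gam_kernel :: "real \<Rightarrow> real \<Rightarrow> real \<Rightarrow> real" where
  "Gam_kernel t \<alpha> \<theta> = upper_Gamma \<alpha> (t / \<theta>) / Gamma \<alpha>"

definition Gam_cdf_estimator ::
    "(nat \<Rightarrow> 'a \<Rightarrow> real) \<Rightarrow> nat \<Rightarrow> real \<Rightarrow> real \<Rightarrow> 'a \<Rightarrow> real" where
  "Gam_cdf_estimator X n b x \<omega> = 1 / real n * (\<Sum>i=1..n. Gam_kernel (X i \<omega>) (x / b + 1) b)"

definition bias :: "'a measure \<Rightarrow> ('a \<Rightarrow> real) \<Rightarrow> real \<Rightarrow> real" where
  "bias M Y \<theta> = (\<integral>\<omega>. Y \<omega> \<partial>M) - \<theta>"

definition mse :: "'a measure \<Rightarrow> ('a \<Rightarrow> real) \<Rightarrow> real \<Rightarrow> real" where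
  "mse M Y \<theta> = (\<integral>\<omega>. (Y \<omega> - \<theta>)\<^sup>2 \<partial>M)"

text \<open>The expansion of the mean squared error of the estimator at \<open>x\<close> without its error terms;
  \<open>f\<close> and \<open>f'\<close> are meant to be the first two derivatives of the c.d.f. \<open>F\<close>.\<close>

definition Gam_amse ::
    "(real \<Rightarrow> real) \<Rightarrow> (real \<Rightarrow> real) \<Rightarrow> (real \<Rightarrow> real) \<Rightarrow> real \<Rightarrow> nat \<Rightarrow> real \<Rightarrow> real" where
  "Gam_amse F f f' x n b =
     1 / real n * (F x * (1 - F x))
     - 1 / real n * sqrt b * (sqrt x * f x / sqrt pi)
     + b\<^sup>2 * (f x + x / 2 * f' x)\<^sup>2"

definition Gam_bopt :: "(real \<Rightarrow> real) \<Rightarrow> (real \<Rightarrow> real) \<Rightarrow> real \<Rightarrow> nat \<Rightarrow> real" where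
  "Gam_bopt f f' x n =
     real n powr (- 2 / 3)
     * (4 * (f x + x / 2 * f' x)\<^sup>2 / (sqrt x * f x / sqrt pi)) powr (- 2 / 3)"

end

theory Submission
  imports Defs "HOL-Real_Asymp.Real_Asymp"
begin

text \<open>
  Write \<open>S, T\<close> for independent standard Gamma variables of shape \<open>a = x / b + 1\<close>. On \<open>y \<ge> 0\<close> the
  kernel is the survival function of \<open>b * S\<close>, so Fubini turns its mean under the data distribution
  into \<open>E F(b S)\<close>, and its second moment into \<open>E F(b min(S, T))\<close>. A Taylor expansion of \<open>F\<close> at
  \<open>x\<close> then gives the bias (second order, the remainder being controlled by the fourth central
  moment of \<open>b S\<close>) and the variance (first order). The term \<open>b\<^sup>1\<^sup>/\<^sup>2\<close> of the variance comes from the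
  exact value \<open>E min(S, T) = a - \<Gamma>(a + 1/2) / (\<surd>\<pi> \<Gamma>(a))\<close>, in which log-convexity of
  the Gamma function pins the Gamma quotient between \<open>\<surd>(a - 1/2)\<close> and \<open>\<surd>a\<close>.
\<close>

section \<open>Gamma function and Gamma density\<close>

text \<open>The accuracies required decide which Taylor bound is used where. The squared bias must
  be right to o(b^2), hence the bias to o(b). A remainder bound \<open>L * (t - x)^2\<close>
  integrates to order b and would swamp the term \<open>x / 2 * f' x\<close>; so the remainder is
  split into \<epsilon> times \<open>(t - x)^2\<close> and a quartic term, whose moment is of order
  b^2. The variance is divided by n and is wanted only up to O(b), so there the bound with
  \<open>L\<close> is enough.

  All estimates are made for functions of a real b; n enters through the factor 1/n and the
  substitution of b_n. This makes the constant \<open>C\<close> independent of the bandwidth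
  sequence.

  The summand 1 in the shape has two effects: \<open>b * S\<close> has mean x + b, the source of
  \<open>f x\<close> in the bias, and a > 1, so the Gamma density is continuous at 0 and its
  survival function differentiable on the whole line. As \<open>F\<close> need not be smooth across
  0, Taylor bounds use derivatives within \<open>{0..}\<close>; the Gamma density vanishes on the
  negative side.

  The duplication formula serves to integrate the square of a Gamma density, which is a multiple of
  a Gamma density at the doubled argument.\<close>

lemma Gamma_legendre_duplication_real:
  fixes z :: real
  assumes "z > 0"
  shows "Gamma z * Gamma (z + 1 / 2) = 2 powr (1 - 2 * z) * sqrt pi * Gamma (2 * z)"
proof -
  have z: "complex_of_real z \<notin> \<int>\<^sub>\<le>\<^sub>0" "complex_of_real z + 1 / 2 \<notin> \<int>\<^sub>\<le>\<^sub>0"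
    using assms by (auto elim!: nonpos_Ints_cases simp: complex_eq_iff)
  have "complex_of_real (Gamma z * Gamma (z + 1 / 2)) =
      complex_of_real (exp ((1 - 2 * z) * ln 2) * sqrt pi * Gamma (2 * z))"
    using Gamma_legendre_duplication[OF z]
    by (simp add: Gamma_complex_of_real [symmetric] exp_of_real [symmetric])
  then show ?thesis
    unfolding of_real_eq_iff by (simp add: powr_def)
qed

lemma Gamma_Suc_real: "a > 0 \<Longrightarrow> Gamma (a + 1) = a * Gamma (a::real)"
  by (intro Gamma_plus1) (auto elim!: nonpos_Ints_cases)

lemma Gamma_midpoint_log_convex:
  fixes a :: real
  assumes "a > 0"
  shows "Gamma (a + 1 / 2) ^ 2 \<le> Gamma a * Gamma (a + 1)"
proof -
  have pos: "Gamma a > 0" "Gamma (a + 1) > 0" "Gamma (a + 1 / 2) > 0"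
    using assms by (auto intro!: Gamma_real_pos)
  have "(ln \<circ> Gamma) ((1 - 1 / 2) *\<^sub>R a + (1 / 2) *\<^sub>R (a + 1))
      \<le> (1 - 1 / 2) * (ln \<circ> Gamma) a + (1 / 2) * (ln \<circ> Gamma) (a + 1)"
    by (rule convex_onD[OF log_convex_Gamma_real]) (use assms in auto)
  also have "(1 - 1 / 2) *\<^sub>R a + (1 / 2) *\<^sub>R (a + 1) = a + 1 / 2"
    by (simp add: field_simps)
  finally have "2 * ln (Gamma (a + 1 / 2)) \<le> ln (Gamma a) + ln (Gamma (a + 1))"
    by (simp add: field_simps)
  then have "ln (Gamma (a + 1 / 2) ^ 2) \<le> ln (Gamma a * Gamma (a + 1))"
    using pos by (simp add: ln_mult ln_realpow)
  then show ?thesis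
    using pos by simp
qed

text \<open>Midpoint log-convexity at \<open>a\<close> gives the upper bound and at
  \<open>a - 1 / 2\<close> the lower one; the functional equation turns each product of two Gamma
  values into a square.\<close>

lemma Gamma_half_ratio_bounds:
  fixes a :: real
  assumes "a > 1 / 2"
  shows "sqrt (a - 1 / 2) \<le> Gamma (a + 1 / 2) / Gamma a"
    and "Gamma (a + 1 / 2) / Gamma a \<le> sqrt a"
proof -
  have pos: "Gamma a > 0" "Gamma (a + 1 / 2) > 0"
    using assms by (auto intro!: Gamma_real_pos)
  have "Gamma (a + 1 / 2) ^ 2 \<le> a * Gamma a ^ 2"
    using Gamma_midpoint_log_convex[of a] assms Gamma_Suc_real[of a]
    by (simp add: power2_eq_square mult_ac)
  then show "Gamma (a + 1 / 2) / Gamma a \<le> sqrt a"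
    using pos by (intro real_le_rsqrt) (simp add: field_simps)
  have "(a - 1 / 2) * Gamma (a - 1 / 2) = Gamma (a + 1 / 2)"
    using assms Gamma_Suc_real[of "a - 1 / 2"] by (simp add: add.commute)
  then have "(a - 1 / 2) * Gamma a ^ 2 \<le> Gamma (a + 1 / 2) ^ 2"
    using mult_left_mono[OF Gamma_midpoint_log_convex[of "a - 1 / 2"], of "a - 1 / 2"] assms
    by (simp add: power2_eq_square mult.assoc [symmetric] add.commute)
  then show "sqrt (a - 1 / 2) \<le> Gamma (a + 1 / 2) / Gamma a"
    using pos by (intro real_le_lsqrt) (auto simp: field_simps)
qed

section \<open>The Gamma density, its moments and its survival function\<close>

definition gam_density :: "real \<Rightarrow> real \<Rightarrow> real" where
  "gam_density a s = indicator {0..} s * s powr (a - 1) * exp (- s) / Gamma a"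

definition gam_surv :: "real \<Rightarrow> real \<Rightarrow> real" where
  "gam_surv a y = (\<integral>s. indicator {y..} s * gam_density a s \<partial>lborel)"

lemma gam_density_measurable [measurable]: "gam_density a \<in> borel_measurable borel"
  unfolding gam_density_def by measurable

lemma gam_density_nonneg: "a > 0 \<Longrightarrow> 0 \<le> gam_density a s"
  unfolding gam_density_def by (simp add: Gamma_real_pos less_imp_le)

lemma gam_density_eq_0: "s < 0 \<Longrightarrow> gam_density a s = 0"
  by (simp add: gam_density_def)

lemma gam_density_has_integral:
  assumes "a > 0"
  shows "has_bochner_integral lborel (gam_density a) 1"
proof (rule has_bochner_integral_nn_integral)
  have pos: "Gamma a > 0"
    using assms by (rule Gamma_real_pos)
  have "(\<integral>\<^sup>+ s. ennreal (gam_density a s) \<partial>lborel)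
      = (\<integral>\<^sup>+ s. ennreal (1 / Gamma a) * ennreal (indicator {0..} s * s powr (a - 1) / exp s) \<partial>lborel)"
    using pos by (intro nn_integral_cong)
      (auto simp: gam_density_def exp_minus field_simps ennreal_mult [symmetric] indicator_def)
  also have "\<dots> = ennreal (1 / Gamma a) * ennreal (Gamma a)"
    by (simp add: nn_integral_cmult Gamma_conv_nn_integral_real[OF assms])
  also have "\<dots> = ennreal 1"
    using pos by (simp add: ennreal_mult [symmetric])
  finally show "(\<integral>\<^sup>+ s. ennreal (gam_density a s) \<partial>lborel) = ennreal 1" .
qed (use assms gam_density_nonneg in auto)

lemma gam_density_integrable [simp]: "a > 0 \<Longrightarrow> integrable lborel (gam_density a)"
  and gam_density_integral: "a > 0 \<Longrightarrow> (\<integral>s. gam_density a s \<partial>lborel) = 1"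
  using gam_density_has_integral[of a] by (auto simp: has_bochner_integral_iff)

text \<open>Size-biasing raises the shape by one, by the functional equation of
  \<open>Gamma\<close>. Iterated, it reduces every moment to the normalization of a density of
  shifted shape.\<close>

lemma mult_gam_density:
  assumes "a > 0"
  shows "s * gam_density a s = a * gam_density (a + 1) s"
proof -
  \<comment> \<open>At \<open>s = 0\<close> both sides are 0, because \<open>0 powr c = 0\<close>
    for every exponent \<open>c\<close>.\<close>
  have "s * s powr (a - 1) = s powr a" if "s \<ge> 0"
    using that by (cases "s = 0") (auto simp: powr_mult_base)
  then show ?thesis
    using assms Gamma_real_pos[OF assms]
    by (auto simp: gam_density_def Gamma_Suc_real indicator_def mult.assoc [symmetric])
qed

lemma power_mult_gam_density:
  assumes "a > 0"
  shows "s ^ j * gam_density a s = pochhammer a j * gam_density (a + real j) s"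
proof (induction j)
  case (Suc j)
  have "s ^ Suc j * gam_density a s = pochhammer a j * (s * gam_density (a + real j) s)"
    using Suc by (simp add: mult_ac)
  also have "\<dots> = pochhammer a (Suc j) * gam_density (a + real (Suc j)) s"
    using assms by (simp add: mult_gam_density pochhammer_Suc add_ac)
  finally show ?case .
qed simp

lemma gam_density_moment:
  assumes "a > 0"
  shows "integrable lborel (\<lambda>s. s ^ j * gam_density a s)"
    and "(\<integral>s. s ^ j * gam_density a s \<partial>lborel) = pochhammer a j"
  using assms by (auto simp: power_mult_gam_density gam_density_integral)

lemma gam_density_isCont:
  assumes "a > 1"
  shows "isCont (gam_density a) s"
proof -
  \<comment> \<open>The truncation \<open>max 0 s\<close> absorbs the indicator, since
    \<open>0 powr (a - 1) = 0\<close>. The exponent is positive, so continuity at 0 is covered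
    too.\<close>
  have eq: "gam_density a = (\<lambda>s. max 0 s powr (a - 1) * exp (- s) / Gamma a)"
    using assms by (auto simp: fun_eq_iff gam_density_def max_def indicator_def)
  show ?thesis
    unfolding eq isCont_def divide_inverse using assms
    by (intro tendsto_mult tendsto_powr' tendsto_intros) auto
qed

lemma gam_density_deriv:
  assumes "a > 0" "s > 0"
  shows "(gam_density (a + 1) has_real_derivative gam_density a s - gam_density (a + 1) s) (at s)"
proof -
  have pos: "Gamma a > 0"
    using assms by (intro Gamma_real_pos)
  have "((\<lambda>s. s powr a * exp (- s) / (a * Gamma a)) has_real_derivative
      gam_density a s - gam_density (a + 1) s) (at s)"
    using assms pos less_imp_neq[OF pos, symmetric] by (auto intro!: derivative_eq_intros
        simp: gam_density_def Gamma_Suc_real powr_diff less_imp_neq)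
        (simp add: field_simps)
  moreover have "\<forall>\<^sub>F s in nhds s. gam_density (a + 1) s = s powr a * exp (- s) / (a * Gamma a)"
    using assms by (intro eventually_mono[OF eventually_nhds_in_open[of "{0<..}" s]])
      (auto simp: gam_density_def Gamma_Suc_real)
  ultimately show ?thesis
    using DERIV_cong_ev[OF refl _ refl] by force
qed

lemma integrable_indicator_gam_density:
  assumes "a > 0"
  shows "integrable lborel (\<lambda>s. indicator {y..} s * gam_density a s)"
  using integrable_mult_indicator[OF _ gam_density_integrable[OF assms], of "{y..}"] by simp

lemma gam_surv_bounds:
  assumes "a > 0"
  shows "0 \<le> gam_surv a y" "gam_surv a y \<le> 1"
proof -
  show "0 \<le> gam_surv a y"
    unfolding gam_surv_def using assms by (intro integral_nonneg_AE) (auto simp: gam_density_nonneg)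
  have "gam_surv a y \<le> (\<integral>s. gam_density a s \<partial>lborel)"
    unfolding gam_surv_def using assms
    by (intro integral_mono integrable_indicator_gam_density)
      (auto simp: gam_density_nonneg indicator_def)
  then show "gam_surv a y \<le> 1"
    using assms by (simp add: gam_density_integral)
qed

lemma gam_surv_0: "a > 0 \<Longrightarrow> gam_surv a 0 = 1"
  unfolding gam_surv_def by (subst gam_density_integral[symmetric, of a], simp,
      intro Bochner_Integration.integral_cong) (auto simp: gam_density_def indicator_def)

text \<open>Markov's inequality: the mean of the density is \<open>a\<close>, so the tail beyond
  \<open>y\<close> has mass at most \<open>a / y\<close>.\<close>

lemma gam_surv_at_top:
  assumes "a > 0"
  shows "(gam_surv a \<longlongrightarrow> 0) at_top"
proof (rule tendsto_sandwich[where f = "\<lambda>_. 0" and h = "\<lambda>y. a / y"])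
  have "gam_surv a y \<le> a / y" if "y > 0" for y
  proof -
    have "y * gam_surv a y \<le> (\<integral>s. s ^ 1 * gam_density a s \<partial>lborel)"
      unfolding gam_surv_def integral_mult_right_zero[symmetric] using assms that
      by (intro integral_mono integrable_mult_right integrable_indicator_gam_density
          gam_density_moment)
        (auto simp: indicator_def gam_density_nonneg mult_right_mono, auto simp: gam_density_def indicator_def Gamma_real_pos less_imp_le)
    then show ?thesis
      using assms that gam_density_moment(2)[OF assms, of 1] by (simp add: field_simps)
  qed
  then show "\<forall>\<^sub>F y in at_top. gam_surv a y \<le> a / y"
    by (intro eventually_mono[OF eventually_gt_at_top[of "0::real"]])
  show "((\<lambda>y. a / y) \<longlongrightarrow> 0) at_top"
    by (intro tendsto_divide_0[OF tendsto_const] filterlim_at_top_imp_at_infinity filterlim_ident)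
qed (use assms in \<open>auto simp: gam_surv_bounds\<close>)

lemma gam_surv_deriv:
  assumes "a > 1"
  shows "(gam_surv a has_real_derivative - gam_density a y) (at y)"
proof -
  have a: "a > 0"
    using assms by simp
  \<comment> \<open>Any base point to the left of \<open>y\<close> would do: the tail from
    \<open>u\<close> is split at \<open>z\<close>, and the fundamental theorem applies to the
    compact piece.\<close>
  define u where "u = y - 1"
  have eq: "gam_surv a z = gam_surv a u - integral {u..z} (gam_density a)" if "u < z" for z
  proof -
    have cont: "continuous_on {u..z} (gam_density a)"
      using gam_density_isCont[OF assms] by (intro continuous_at_imp_continuous_on) auto
    have int: "set_integrable lborel {u..z} (gam_density a)"
      using cont by (rule borel_integrable_atLeastAtMost')
    \<comment> \<open>The two ranges overlap in the point \<open>z\<close>, so the integrands agree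
      only almost everywhere.\<close>
    have "gam_surv a u = (\<integral>s. indicator {u..z} s * gam_density a s
        + indicator {z..} s * gam_density a s \<partial>lborel)"
      unfolding gam_surv_def
      by (intro integral_cong_AE eventually_mono[OF AE_lborel_singleton[of z]])
        (use that in \<open>auto simp: indicator_def\<close>)
    also have "\<dots> = (\<integral>s. indicator {u..z} s * gam_density a s \<partial>lborel) + gam_surv a z"
      unfolding gam_surv_def using int a
      by (intro Bochner_Integration.integral_add integrable_indicator_gam_density)
        (auto simp: set_integrable_def)
    also have "(\<integral>s. indicator {u..z} s * gam_density a s \<partial>lborel) = integral {u..z} (gam_density a)"
      using set_borel_integral_eq_integral(2)[OF int]
      by (simp add: set_lebesgue_integral_def)
    finally show ?thesis by simp
  qed
  have "((\<lambda>z. integral {u..z} (gam_density a)) has_real_derivative gam_density a y)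
      (at y within {u..y + 1})"
    by (rule integral_has_real_derivative)
      (auto simp: u_def intro!: continuous_at_imp_continuous_on gam_density_isCont assms)
  then have "((\<lambda>z. integral {u..z} (gam_density a)) has_real_derivative gam_density a y) (at y)"
    by (subst (asm) at_within_interior) (auto simp: u_def)
  then have "((\<lambda>z. gam_surv a u - integral {u..z} (gam_density a))
      has_real_derivative - gam_density a y) (at y)"
    by (auto intro!: derivative_eq_intros)
  moreover have "\<forall>\<^sub>F z in nhds y. gam_surv a z = gam_surv a u - integral {u..z} (gam_density a)"
    using eventually_nhds_in_open[of "{u<..}" y] eq
    by (auto elim!: eventually_mono simp: u_def)
  ultimately show ?thesis
    using DERIV_cong_ev[OF refl _ refl] by force
qed

lemma gam_surv_measurable [measurable]: "gam_surv a \<in> borel_measurable borel"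
  unfolding gam_surv_def indicator_def atLeast_iff by measurable

section \<open>Minimum of two independent Gamma variables\<close>

text \<open>The normalized form of the integration-by-parts recurrence for the incomplete Gamma
  function. The difference of the two sides has derivative 0 on the positive half line and tends to
  0 at infinity.\<close>

lemma gam_surv_Suc:
  assumes "a > 1" "y > 0"
  shows "gam_surv (a + 1) y = gam_surv a y + gam_density (a + 1) y"
proof -
  define D where "D y = gam_surv (a + 1) y - gam_surv a y - gam_density (a + 1) y" for y
  have gam_density_lim: "(gam_density (a + 1) \<longlongrightarrow> 0) at_top"
  proof (rule Lim_transform_eventually)
    have "((\<lambda>s. s powr a / exp s * (1 / Gamma (a + 1))) \<longlongrightarrow> 0 * (1 / Gamma (a + 1))) at_top"
      by (intro tendsto_mult tendsto_const) real_asymp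
    then show "((\<lambda>s. s powr a / exp s / Gamma (a + 1)) \<longlongrightarrow> 0) at_top"
      by simp
    show "\<forall>\<^sub>F s in at_top. s powr a / exp s / Gamma (a + 1) = gam_density (a + 1) s"
      by (intro eventually_mono[OF eventually_gt_at_top[of "0::real"]])
        (auto simp: gam_density_def exp_minus divide_inverse)
  qed
  have "(D has_real_derivative 0) (at s within {0<..})" if "s \<in> {0<..}" for s
  proof (rule has_field_derivative_at_within)
    have "(D has_real_derivative - gam_density (a + 1) s - (- gam_density a s)
        - (gam_density a s - gam_density (a + 1) s)) (at s)"
      unfolding D_def using assms that
      by (intro DERIV_diff gam_surv_deriv gam_density_deriv) auto
    then show "(D has_real_derivative 0) (at s)"
      by simp
  qed
  then have "\<exists>c. \<forall>s \<in> {0<..}. D s = c"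
    by (intro has_field_derivative_zero_constant) auto
  then obtain c where c: "\<And>s. s > 0 \<Longrightarrow> D s = c"
    by auto
  have "(D \<longlongrightarrow> 0 - 0 - 0) at_top"
    unfolding D_def using assms by (intro tendsto_diff gam_surv_at_top gam_density_lim) auto
  moreover have "(D \<longlongrightarrow> c) at_top"
    by (rule tendsto_eventually, rule eventually_mono[OF eventually_gt_at_top[of "0::real"]])
      (rule c)
  ultimately have "c = 0"
    using tendsto_unique[of at_top D c 0] by simp
  then show ?thesis
    using c[OF assms(2)] by (simp add: D_def)
qed

text \<open>If \<open>S, T\<close> are independent with the Gamma density, this is the density of \<open>min S T\<close>.\<close>

definition gam_min_density :: "real \<Rightarrow> real \<Rightarrow> real" where
  "gam_min_density a s = 2 * gam_density a s * gam_surv a s"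

lemma gam_min_density_measurable [measurable]: "gam_min_density a \<in> borel_measurable borel"
  unfolding gam_min_density_def by measurable

lemma gam_min_density_nonneg: "a > 0 \<Longrightarrow> 0 \<le> gam_min_density a s"
  by (simp add: gam_min_density_def gam_density_nonneg gam_surv_bounds)

lemma gam_min_density_le: "a > 0 \<Longrightarrow> gam_min_density a s \<le> 2 * gam_density a s"
  unfolding gam_min_density_def by (simp add: gam_density_nonneg gam_surv_bounds mult_left_le)

text \<open>\<open>- (gam_surv a y ^ 2)\<close> is an antiderivative vanishing at infinity. The
  value is the square of the kernel, which is how this density comes to describe the kernel's second
  moment.\<close>

lemma gam_min_density_tail:
  assumes "a > 1"
  shows "has_bochner_integral lborel (\<lambda>s. indicator {y..} s * gam_min_density a s) (gam_surv a y ^ 2)"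
proof (rule has_bochner_integral_nn_integral)
  have "(\<integral>\<^sup>+ s. ennreal (indicator {y..} s * gam_min_density a s) \<partial>lborel)
      = (\<integral>\<^sup>+ s. ennreal (gam_min_density a s) * indicator {y..} s \<partial>lborel)"
    by (intro nn_integral_cong) (auto simp: indicator_def)
  also have "\<dots> = ennreal (0 - (- (gam_surv a y ^ 2)))"
  proof (rule nn_integral_FTC_atLeast)
    show "((\<lambda>y. - (gam_surv a y ^ 2)) has_real_derivative gam_min_density a s) (at s)" for s
      using gam_surv_deriv[OF assms, of s]
      by (auto intro!: derivative_eq_intros simp: gam_min_density_def)
    have "((\<lambda>y. - (gam_surv a y ^ 2)) \<longlongrightarrow> - (0 ^ 2)) at_top"
      using assms by (intro tendsto_intros gam_surv_at_top) auto
    then show "((\<lambda>y. - (gam_surv a y ^ 2)) \<longlongrightarrow> 0) at_top"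
      by simp
  qed (use assms gam_min_density_nonneg in auto)
  finally show "(\<integral>\<^sup>+ s. ennreal (indicator {y..} s * gam_min_density a s) \<partial>lborel)
      = ennreal (gam_surv a y ^ 2)"
    by simp
qed (use assms gam_min_density_nonneg in auto)

lemma gam_min_density_eq_0: "s < 0 \<Longrightarrow> gam_min_density a s = 0"
  by (simp add: gam_min_density_def gam_density_def)

lemma gam_min_density_has_integral:
  assumes "a > 1"
  shows "has_bochner_integral lborel (gam_min_density a) 1"
proof -
  have "(\<lambda>s. indicator {0..} s * gam_min_density a s) = gam_min_density a"
    by (auto simp: fun_eq_iff indicator_def gam_min_density_eq_0 not_le)
  then show ?thesis
    using gam_min_density_tail[OF assms, of 0] assms by (simp add: gam_surv_0)
qed

text \<open>The square is \<open>c\<close> times the density of shape \<open>2 * a + 1\<close> at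
  \<open>2 * s\<close>. The change of scale contributes the factor 1/2, and the duplication formula
  at \<open>a + 1 / 2\<close> evaluates \<open>c\<close>.\<close>

lemma gam_density_square_integral:
  assumes "a > 0"
  shows "has_bochner_integral lborel (\<lambda>s. gam_density (a + 1) s ^ 2)
    (Gamma (a + 1 / 2) / (2 * a * sqrt pi * Gamma a))"
proof -
  define c where "c = Gamma (2 * a + 1) / (2 powr (2 * a) * Gamma (a + 1) ^ 2)"
  have pos: "Gamma a > 0" "Gamma (a + 1) > 0" "Gamma (2 * a + 1) > 0"
    using assms by (auto intro!: Gamma_real_pos)
  have "gam_density (a + 1) s ^ 2 = c * gam_density (2 * a + 1) (2 * s)" for s
  proof (cases "s \<ge> 0")
    case True
    have "(s powr a) ^ 2 = s powr (2 * a)"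
      unfolding power2_eq_square mult_2 by (rule powr_add [symmetric])
    moreover have "exp (- s) ^ 2 = exp (- (2 * s))"
      by (simp add: exp_double [symmetric])
    ultimately show ?thesis
      using True pos
      by (simp add: gam_density_def c_def powr_mult power_divide power_mult_distrib)
  qed (simp add: gam_density_def)
  moreover have "has_bochner_integral lborel (\<lambda>s. gam_density (2 * a + 1) (0 + 2 * s)) (1 /\<^sub>R \<bar>2\<bar>)"
    using gam_density_has_integral[of "2 * a + 1"] assms
    by (subst lborel_has_bochner_integral_real_affine_iff[symmetric]) auto
  ultimately have "has_bochner_integral lborel (\<lambda>s. gam_density (a + 1) s ^ 2) (c / 2)"
    using has_bochner_integral_mult_right[of c lborel "\<lambda>s. gam_density (2 * a + 1) (2 * s)" "1/2"]
    by simp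
  moreover have "c / 2 = Gamma (a + 1 / 2) / (2 * a * sqrt pi * Gamma a)"
  proof -
    have "Gamma (a + 1 / 2) * Gamma (a + 1) = 2 powr (- 2 * a) * sqrt pi * Gamma (2 * a + 1)"
      using Gamma_legendre_duplication_real[of "a + 1 / 2"] assms by (simp add: algebra_simps)
    then have "Gamma (2 * a + 1) = 2 powr (2 * a) * (Gamma (a + 1 / 2) * Gamma (a + 1)) / sqrt pi"
      by (simp add: powr_minus field_simps)
    then have "c = Gamma (a + 1 / 2) / (sqrt pi * Gamma (a + 1))"
      using pos by (simp add: c_def power2_eq_square)
    then show ?thesis
      using assms by (simp add: Gamma_Suc_real)
  qed
  ultimately show ?thesis
    by simp
qed

text \<open>Since \<open>s * gam_density a s = a * gam_density (a + 1) s\<close> and the survival function at \<open>a\<close>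
  is the one at \<open>a + 1\<close> minus \<open>gam_density (a + 1) s\<close>, the mean reduces to the two preceding
  integrals.\<close>

lemma gam_min_density_mean:
  assumes "a > 1"
  shows "has_bochner_integral lborel (\<lambda>s. s * gam_min_density a s)
    (a - Gamma (a + 1 / 2) / (sqrt pi * Gamma a))"
proof -
  have eq: "s * gam_min_density a s
      = a * gam_min_density (a + 1) s - 2 * a * gam_density (a + 1) s ^ 2" for s
  proof (cases "s > 0")
    case True
    have "s * gam_min_density a s = 2 * (s * gam_density a s) * gam_surv a s"
      by (simp add: gam_min_density_def)
    also have "\<dots> = 2 * (a * gam_density (a + 1) s)
        * (gam_surv (a + 1) s - gam_density (a + 1) s)"
      using assms True gam_surv_Suc[of a s] mult_gam_density[of a s] by simp
    finally show ?thesis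
      by (simp add: gam_min_density_def algebra_simps power2_eq_square)
  next
    \<comment> \<open>The point \<open>s = 0\<close> falls in this case; the density of shape
      \<open>a + 1\<close> is 0 there because \<open>0 powr a = 0\<close>.\<close>
    case False
    then have "gam_density (a + 1) s = 0" "s * gam_density a s = 0"
      using assms by (auto simp: gam_density_def indicator_def)
    then show ?thesis
      by (auto simp: gam_min_density_def)
  qed
  have "has_bochner_integral lborel
      (\<lambda>s. a * gam_min_density (a + 1) s - 2 * a * gam_density (a + 1) s ^ 2)
      (a * 1 - 2 * a * (Gamma (a + 1 / 2) / (2 * a * sqrt pi * Gamma a)))"
    using assms
    by (intro has_bochner_integral_diff has_bochner_integral_mult_right
        gam_min_density_has_integral gam_density_square_integral) auto
  then show ?thesis
    using assms by (simp add: eq)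
qed

section \<open>Kernel moments as integrals of the c.d.f.\<close>

text \<open>The negative half line is a countable union of the rays
  \<open>{..- (1 / real (Suc n))}\<close>, each of mass 0. An atom at 0 remains possible.\<close>

lemma (in real_distribution) AE_nonneg_of_cdf:
  assumes "\<And>t. t < 0 \<Longrightarrow> cdf M t = 0"
  shows "AE y in M. 0 \<le> y"
proof -
  have "AE y in M. - (1 / real (Suc n)) < y" for n
  proof -
    have "prob {.. - (1 / real (Suc n))} = 0"
      using assms[of "- (1 / real (Suc n))"] by (simp add: cdf_def)
    then have "AE y in M. y \<notin> {.. - (1 / real (Suc n))}"
      by (subst (asm) prob_eq_0) auto
    then show ?thesis
      by (rule AE_mp) (auto intro!: AE_I2)
  qed
  then have "AE y in M. \<forall>n. - (1 / real (Suc n)) < y"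
    by (simp add: AE_all_countable)
  then show ?thesis
  proof (rule AE_mp, intro AE_I2 impI)
    fix y assume y: "\<forall>n. - (1 / real (Suc n)) < y"
    show "0 \<le> y"
    proof (rule ccontr)
      assume "\<not> 0 \<le> y"
      then obtain n where "1 / real (Suc n) < - y"
        using reals_Archimedean[of "- y"] by (auto simp: inverse_eq_divide)
      with y show False
        by (metis less_asym minus_less_iff)
    qed
  qed
qed

text \<open>Fubini on the region \<open>y / b <= s\<close>, which for fixed \<open>s\<close> is the
  ray \<open>y <= b * s\<close>. The weight is general because two instances occur:
  \<open>gam_density a\<close> for the kernel and \<open>gam_min_density a\<close> for its
  square.\<close>

lemma (in real_distribution) integral_tail_eq_integral_cdf:
  fixes w :: "real \<Rightarrow> real"
  assumes w: "integrable lborel w" "\<And>s. 0 \<le> w s" and "b > 0"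
  shows "(\<integral>y. (\<integral>s. indicator {y / b..} s * w s \<partial>lborel) \<partial>M) = (\<integral>s. w s * cdf M (b * s) \<partial>lborel)"
proof -
  interpret pair_sigma_finite M lborel ..
  define h where "h y s = (if y / b \<le> s then w s else 0)" for y s
  have wm [measurable]: "w \<in> borel_measurable borel"
    using w(1) by auto
  have hm [measurable]: "case_prod h \<in> borel_measurable (M \<Otimes>\<^sub>M lborel)"
    unfolding h_def by measurable
  have int: "integrable lborel (h y)" for y
    using w by (intro Bochner_Integration.integrable_bound[OF w(1)]) (auto simp: h_def)
  have "integrable (M \<Otimes>\<^sub>M lborel) (case_prod h)"
  proof (rule Fubini_integrable)
    show "integrable M (\<lambda>y. \<integral>s. norm (case_prod h (y, s)) \<partial>lborel)"
    proof (rule integrable_const_bound[of _ "\<integral>s. w s \<partial>lborel"])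
      have "(\<integral>s. \<bar>h y s\<bar> \<partial>lborel) \<le> (\<integral>s. w s \<partial>lborel)" for y
        by (rule integral_mono[OF integrable_abs[OF int] w(1)]) (auto simp: h_def w)
      then show "AE y in M. norm (\<integral>s. norm (case_prod h (y, s)) \<partial>lborel) \<le> (\<integral>s. w s \<partial>lborel)"
        by simp
    qed measurable
  qed (use int in auto)
  then have swap: "(\<integral>s. (\<integral>y. h y s \<partial>M) \<partial>lborel) = (\<integral>y. (\<integral>s. h y s \<partial>lborel) \<partial>M)"
    by (rule Fubini_integral)
  have inner: "(\<integral>y. h y s \<partial>M) = w s * cdf M (b * s)" for s
  proof -
    have "(\<integral>y. h y s \<partial>M) = (\<integral>y. w s * indicator {..b * s} y \<partial>M)"
      using \<open>b > 0\<close> by (intro Bochner_Integration.integral_cong)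
        (auto simp: h_def indicator_def field_simps)
    then show ?thesis
      by (simp add: cdf_def)
  qed
  have "indicator {y / b..} s * w s = h y s" for y s
    by (simp add: h_def indicator_def)
  then show ?thesis
    by (simp only: swap [symmetric] inner)
qed

lemma Gam_kernel_measurable [measurable]: "(\<lambda>y. Gam_kernel y a b) \<in> borel_measurable borel"
  unfolding Gam_kernel_def upper_Gamma_def set_lebesgue_integral_def indicator_def atLeast_iff
  by measurable

text \<open>For \<open>y >= 0\<close> the range of integration stays in the half line where the
  integrands agree. For negative \<open>y\<close> the kernel would also integrate
  \<open>t powr (a - 1)\<close> over negative \<open>t\<close>, which \<open>gam_density\<close>
  cuts off.\<close>

lemma Gam_kernel_eq_gam_surv:
  assumes "y \<ge> 0" "b > 0"
  shows "Gam_kernel y a b = gam_surv a (y / b)"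
proof -
  have "(\<integral>s. indicator {y / b..} s * gam_density a s \<partial>lborel) =
      (\<integral>s. indicator {y / b..} s *\<^sub>R (s powr (a - 1) * exp (- s)) / Gamma a \<partial>lborel)"
    using order_trans[OF divide_nonneg_pos[OF assms]]
    by (intro Bochner_Integration.integral_cong) (auto simp: gam_density_def indicator_def)
  then show ?thesis
    by (simp add: Gam_kernel_def upper_Gamma_def gam_surv_def set_lebesgue_integral_def)
qed

lemma (in real_distribution) Gam_kernel_moments:
  assumes cdf: "\<And>t. t < 0 \<Longrightarrow> cdf M t = 0" and "a > 1" "b > 0"
  shows "AE y in M. 0 \<le> Gam_kernel y a b \<and> Gam_kernel y a b \<le> 1"
    and "(\<integral>y. Gam_kernel y a b \<partial>M) = (\<integral>s. gam_density a s * cdf M (b * s) \<partial>lborel)"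
    and "(\<integral>y. (Gam_kernel y a b)\<^sup>2 \<partial>M) = (\<integral>s. gam_min_density a s * cdf M (b * s) \<partial>lborel)"
proof -
  have AE: "AE y in M. Gam_kernel y a b = gam_surv a (y / b)"
    using AE_nonneg_of_cdf[OF cdf] by (rule AE_mp) (use assms in \<open>auto simp: Gam_kernel_eq_gam_surv\<close>)
  then show "AE y in M. 0 \<le> Gam_kernel y a b \<and> Gam_kernel y a b \<le> 1"
    by (rule AE_mp) (use assms in \<open>auto simp: gam_surv_bounds\<close>)
  have "(\<integral>y. Gam_kernel y a b \<partial>M) = (\<integral>y. gam_surv a (y / b) \<partial>M)"
    using AE by (intro integral_cong_AE) auto
  also have "\<dots> = (\<integral>s. gam_density a s * cdf M (b * s) \<partial>lborel)"
    unfolding gam_surv_def using assms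
    by (intro integral_tail_eq_integral_cdf) (auto simp: gam_density_nonneg)
  finally show "(\<integral>y. Gam_kernel y a b \<partial>M) = (\<integral>s. gam_density a s * cdf M (b * s) \<partial>lborel)" .
  have "(\<integral>y. (Gam_kernel y a b)\<^sup>2 \<partial>M) = (\<integral>y. (gam_surv a (y / b))\<^sup>2 \<partial>M)"
    using AE by (intro integral_cong_AE) auto
  \<comment> \<open>The squared survival function is itself a tail integral, so the same exchange of
    integrals applies with the density of the minimum as weight.\<close>
  also have "\<dots> = (\<integral>y. (\<integral>s. indicator {y / b..} s * gam_min_density a s \<partial>lborel) \<partial>M)"
    using has_bochner_integral_integral_eq[OF gam_min_density_tail] assms by simp
  also have "\<dots> = (\<integral>s. gam_min_density a s * cdf M (b * s) \<partial>lborel)"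
    using assms gam_min_density_has_integral
    by (intro integral_tail_eq_integral_cdf) (auto simp: gam_min_density_nonneg has_bochner_integral_iff)
  finally show "(\<integral>y. (Gam_kernel y a b)\<^sup>2 \<partial>M) = (\<integral>s. gam_min_density a s * cdf M (b * s) \<partial>lborel)" .
qed

section \<open>Taylor expansions\<close>

text \<open>Mean value inequality on the segment from \<open>x\<close> to \<open>t\<close>, where
  the derivative is at most \<open>c * \<bar>t - x\<bar>\<close>. Integration would give
  \<open>c / 2\<close>; the loss only affects constants. Derivatives within \<open>S\<close> admit
  the endpoint of the half line.\<close>

lemma quadratic_bound_of_deriv_bound:
  fixes G g :: "real \<Rightarrow> real"
  assumes "convex S" "x \<in> S" "t \<in> S" "G x = 0" "c \<ge> 0"
    and deriv: "\<And>u. u \<in> S \<Longrightarrow> (G has_real_derivative g u) (at u within S)"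
    and bound: "\<And>u. u \<in> S \<Longrightarrow> \<bar>g u\<bar> \<le> c * \<bar>u - x\<bar>"
  shows "\<bar>G t\<bar> \<le> c * (t - x)\<^sup>2"
proof -
  have sub: "closed_segment x t \<subseteq> S"
    using assms by (simp add: closed_segment_subset)
  have "norm (G t - G x) \<le> c * \<bar>t - x\<bar> * norm (t - x)"
  proof (rule field_differentiable_bound[of "closed_segment x t" G g])
    fix u assume u: "u \<in> closed_segment x t"
    show "(G has_real_derivative g u) (at u within closed_segment x t)"
      using deriv sub u by (blast intro: DERIV_subset)
    have "\<bar>u - x\<bar> \<le> \<bar>t - x\<bar>"
      using segment_bound1[OF u] by (simp add: abs_minus_commute)
    then have "c * \<bar>u - x\<bar> \<le> c * \<bar>t - x\<bar>"
      using assms by (intro mult_left_mono) auto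
    then show "norm (g u) \<le> c * \<bar>t - x\<bar>"
      using bound[of u] sub u by auto
  qed auto
  then show ?thesis
    using assms by (simp add: power2_eq_square abs_mult_self_eq mult.assoc)
qed

lemma taylor_quadratic_remainder:
  fixes F f f' :: "real \<Rightarrow> real"
  assumes "convex S" "x \<in> S" "t \<in> S" "L \<ge> 0"
    and F: "\<And>u. u \<in> S \<Longrightarrow> (F has_real_derivative f u) (at u within S)"
    and f: "\<And>u. u \<in> S \<Longrightarrow> (f has_real_derivative f' u) (at u within S)"
    and L: "\<And>u. u \<in> S \<Longrightarrow> \<bar>f' u\<bar> \<le> L"
  shows "\<bar>F t - F x - f x * (t - x)\<bar> \<le> L * (t - x)\<^sup>2"
proof (rule quadratic_bound_of_deriv_bound[of S x t "\<lambda>u. F u - F x - f x * (u - x)" L "\<lambda>u. f u - f x"])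
  fix u assume u: "u \<in> S"
  show "((\<lambda>u. F u - F x - f x * (u - x)) has_real_derivative f u - f x) (at u within S)"
    using F[OF u] by (auto intro!: derivative_eq_intros)
  show "\<bar>f u - f x\<bar> \<le> L * \<bar>u - x\<bar>"
    using field_differentiable_bound[of S f f' L u x] assms u by simp
qed (use assms in auto)

lemma taylor_peano_remainder:
  fixes F f :: "real \<Rightarrow> real"
  assumes "convex S" "x \<in> S" "\<epsilon> > 0"
    and F: "\<And>u. u \<in> S \<Longrightarrow> (F has_real_derivative f u) (at u within S)"
    and f: "(f has_real_derivative f'x) (at x within S)"
  obtains \<delta> where "\<delta> > 0" and "\<And>t. t \<in> S \<Longrightarrow> \<bar>t - x\<bar> < \<delta> \<Longrightarrow>
      \<bar>F t - F x - f x * (t - x) - f'x / 2 * (t - x)\<^sup>2\<bar> \<le> \<epsilon> * (t - x)\<^sup>2"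
proof -
  obtain \<delta> where \<delta>: "\<delta> > 0" "\<And>u. u \<in> S \<Longrightarrow> \<bar>u - x\<bar> < \<delta> \<Longrightarrow>
      \<bar>f u - f x - f'x * (u - x)\<bar> \<le> \<epsilon> * \<bar>u - x\<bar>"
    using f \<open>\<epsilon> > 0\<close> unfolding has_field_derivative_def has_derivative_within_alt by auto
  show ?thesis
  proof (rule that[OF \<delta>(1)])
    fix t assume t: "t \<in> S" "\<bar>t - x\<bar> < \<delta>"
    show "\<bar>F t - F x - f x * (t - x) - f'x / 2 * (t - x)\<^sup>2\<bar> \<le> \<epsilon> * (t - x)\<^sup>2"
    \<comment> \<open>Intersecting with the ball preserves convexity. The derivative of the
      remainder is the first-order remainder of \<open>f\<close>, which is at most \<epsilon> times
      the distance there.\<close>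
    proof (rule quadratic_bound_of_deriv_bound[of "S \<inter> ball x \<delta>" x t
          "\<lambda>u. F u - F x - f x * (u - x) - f'x / 2 * (u - x)\<^sup>2" \<epsilon>
          "\<lambda>u. f u - f x - f'x * (u - x)"])
      fix u assume u: "u \<in> S \<inter> ball x \<delta>"
      have "(F has_real_derivative f u) (at u within S \<inter> ball x \<delta>)"
        using F u by (blast intro: DERIV_subset)
      then show "((\<lambda>u. F u - F x - f x * (u - x) - f'x / 2 * (u - x)\<^sup>2)
          has_real_derivative f u - f x - f'x * (u - x)) (at u within S \<inter> ball x \<delta>)"
        by (auto intro!: derivative_eq_intros)
      show "\<bar>f u - f x - f'x * (u - x)\<bar> \<le> \<epsilon> * \<bar>u - x\<bar>"
        using u \<delta>(2)[of u] by (auto simp: dist_real_def abs_minus_commute)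
    qed (use assms \<delta> t in \<open>auto simp: convex_Int dist_real_def abs_minus_commute\<close>)
  qed
qed

text \<open>At distance at least \<delta> from \<open>x\<close>, \<open>(t - x)^2\<close> is at most
  \<open>(t - x)^4\<close> divided by the square of \<delta>. So the far region, where no smallness
  is available, is charged to the fourth moment.\<close>

lemma taylor_quartic_remainder:
  fixes F f f' :: "real \<Rightarrow> real"
  assumes "convex S" "x \<in> S" "L \<ge> 0" "\<epsilon> > 0"
    and F: "\<And>u. u \<in> S \<Longrightarrow> (F has_real_derivative f u) (at u within S)"
    and f: "\<And>u. u \<in> S \<Longrightarrow> (f has_real_derivative f' u) (at u within S)"
    and L: "\<And>u. u \<in> S \<Longrightarrow> \<bar>f' u\<bar> \<le> L"
  obtains K where "K \<ge> 0" and "\<And>t. t \<in> S \<Longrightarrow>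
      \<bar>F t - F x - f x * (t - x) - f' x / 2 * (t - x)\<^sup>2\<bar> \<le> \<epsilon> * (t - x)\<^sup>2 + K * (t - x) ^ 4"
proof -
  obtain \<delta> where \<delta>: "\<delta> > 0" "\<And>t. t \<in> S \<Longrightarrow> \<bar>t - x\<bar> < \<delta> \<Longrightarrow>
      \<bar>F t - F x - f x * (t - x) - f' x / 2 * (t - x)\<^sup>2\<bar> \<le> \<epsilon> * (t - x)\<^sup>2"
    using taylor_peano_remainder[OF assms(1,2,4) F f] assms(2) by blast
  show ?thesis
  \<comment> \<open>One \<open>L\<close> pays for the first-order remainder, the other for the
    subtracted second-order term.\<close>
  proof (rule that[of "2 * L / \<delta>\<^sup>2"])
    fix t assume t: "t \<in> S"
    show "\<bar>F t - F x - f x * (t - x) - f' x / 2 * (t - x)\<^sup>2\<bar>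
        \<le> \<epsilon> * (t - x)\<^sup>2 + 2 * L / \<delta>\<^sup>2 * (t - x) ^ 4"
    proof (cases "\<bar>t - x\<bar> < \<delta>")
      case True
      have "0 \<le> 2 * L / \<delta>\<^sup>2 * (t - x) ^ 4"
        using assms by simp
      then show ?thesis
        using \<delta>(2)[OF t True] by linarith
    next
      case False
      have "\<bar>F t - F x - f x * (t - x)\<bar> \<le> L * (t - x)\<^sup>2"
        by (rule taylor_quadratic_remainder[of S x t L F f f']) (use assms t in auto)
      moreover have "\<bar>f' x / 2 * (t - x)\<^sup>2\<bar> \<le> L * (t - x)\<^sup>2"
        unfolding abs_mult abs_power2 using L[OF assms(2)] by (intro mult_right_mono) auto
      moreover have "2 * L * (t - x)\<^sup>2 \<le> 2 * L / \<delta>\<^sup>2 * (t - x) ^ 4"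
      proof -
        have "\<delta>\<^sup>2 \<le> (t - x)\<^sup>2"
          using False \<delta>(1) by (simp add: abs_le_square_iff [symmetric])
        then have "2 * L * (t - x)\<^sup>2 * \<delta>\<^sup>2 \<le> 2 * L * (t - x)\<^sup>2 * (t - x)\<^sup>2"
          using assms by (intro mult_left_mono) auto
        then show ?thesis
          using \<delta>(1) by (simp add: field_simps power4_eq_xxxx power2_eq_square)
      qed
      moreover have "0 \<le> \<epsilon> * (t - x)\<^sup>2"
        using assms by simp
      ultimately show ?thesis
        by linarith
    qed
  qed (use assms in auto)
qed

section \<open>Bias and variance expansions\<close>

text \<open>The factors of \<open>b ^ j * pochhammer a j\<close> are \<open>a * b + i * b\<close>,
  and \<open>a * b = x + b\<close>. Each moment thereby becomes a polynomial in \<open>x\<close> and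
  \<open>b\<close>. The powers are centred at \<open>x\<close>, not at the mean
  \<open>x + b\<close>, so the first moment is \<open>b\<close> rather than 0.\<close>

lemma gam_density_central_moments:
  assumes "x > 0" "b > 0" and a: "a = x / b + 1"
  shows "has_bochner_integral lborel (\<lambda>s. (b * s - x) * gam_density a s) b"
    and "has_bochner_integral lborel (\<lambda>s. (b * s - x)\<^sup>2 * gam_density a s) (x * b + 2 * b\<^sup>2)"
    and "has_bochner_integral lborel (\<lambda>s. (b * s - x) ^ 4 * gam_density a s)
      (3 * x\<^sup>2 * b\<^sup>2 + 26 * x * b ^ 3 + 24 * b ^ 4)"
proof -
  have apos: "a > 0"
    using assms by (simp add: add_pos_pos)
  have ab: "a * b = x + b"
    using assms by (simp add: field_simps)
  have m: "has_bochner_integral lborel (\<lambda>s. c * (s ^ j * gam_density a s)) (c * pochhammer a j)" for c j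
    using gam_density_moment[OF apos, of j] by (simp add: has_bochner_integral_iff)
  have "has_bochner_integral lborel
      (\<lambda>s. b * (s ^ 1 * gam_density a s) + - x * (s ^ 0 * gam_density a s))
      (b * pochhammer a 1 + - x * pochhammer a 0)"
    by (intro has_bochner_integral_add m)
  moreover have "b * pochhammer a 1 + - x * pochhammer a 0 = b"
    using ab by (simp add: mult.commute)
  ultimately show "has_bochner_integral lborel (\<lambda>s. (b * s - x) * gam_density a s) b"
    by (simp add: algebra_simps)
  have "has_bochner_integral lborel
      (\<lambda>s. b\<^sup>2 * (s ^ 2 * gam_density a s) + (- 2 * x * b) * (s ^ 1 * gam_density a s)
        + x\<^sup>2 * (s ^ 0 * gam_density a s))
      (b\<^sup>2 * pochhammer a 2 + (- 2 * x * b) * pochhammer a 1 + x\<^sup>2 * pochhammer a 0)"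
    by (intro has_bochner_integral_add m)
  moreover have "b\<^sup>2 * pochhammer a 2 + (- 2 * x * b) * pochhammer a 1 + x\<^sup>2 * pochhammer a 0
      = (a * b) * (a * b + b) - 2 * x * (a * b) + x\<^sup>2"
    by (simp add: pochhammer_Suc numeral_eq_Suc algebra_simps)
  moreover have "\<dots> = x * b + 2 * b\<^sup>2"
    unfolding ab by (simp add: algebra_simps power2_eq_square)
  ultimately show "has_bochner_integral lborel (\<lambda>s. (b * s - x)\<^sup>2 * gam_density a s) (x * b + 2 * b\<^sup>2)"
    by (simp add: algebra_simps power2_eq_square)
  have "has_bochner_integral lborel
      (\<lambda>s. b ^ 4 * (s ^ 4 * gam_density a s) + (- 4 * x * b ^ 3) * (s ^ 3 * gam_density a s)
        + (6 * x\<^sup>2 * b\<^sup>2) * (s ^ 2 * gam_density a s)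
        + (- 4 * x ^ 3 * b) * (s ^ 1 * gam_density a s) + x ^ 4 * (s ^ 0 * gam_density a s))
      (b ^ 4 * pochhammer a 4 + (- 4 * x * b ^ 3) * pochhammer a 3
        + (6 * x\<^sup>2 * b\<^sup>2) * pochhammer a 2
        + (- 4 * x ^ 3 * b) * pochhammer a 1 + x ^ 4 * pochhammer a 0)"
    by (intro has_bochner_integral_add m)
  moreover have "b ^ 4 * pochhammer a 4 + (- 4 * x * b ^ 3) * pochhammer a 3
        + (6 * x\<^sup>2 * b\<^sup>2) * pochhammer a 2
        + (- 4 * x ^ 3 * b) * pochhammer a 1 + x ^ 4 * pochhammer a 0
      = (a * b) * (a * b + b) * (a * b + 2 * b) * (a * b + 3 * b)
        - 4 * x * ((a * b) * (a * b + b) * (a * b + 2 * b))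
        + 6 * x\<^sup>2 * ((a * b) * (a * b + b)) - 4 * x ^ 3 * (a * b) + x ^ 4"
    by (simp add: pochhammer_Suc numeral_eq_Suc) algebra
  moreover have "\<dots> = 3 * x\<^sup>2 * b\<^sup>2 + 26 * x * b ^ 3 + 24 * b ^ 4"
    unfolding ab by algebra
  moreover have "(\<lambda>s. (b * s - x) ^ 4 * gam_density a s) =
      (\<lambda>s. b ^ 4 * (s ^ 4 * gam_density a s) + (- 4 * x * b ^ 3) * (s ^ 3 * gam_density a s)
        + (6 * x\<^sup>2 * b\<^sup>2) * (s ^ 2 * gam_density a s)
        + (- 4 * x ^ 3 * b) * (s ^ 1 * gam_density a s) + x ^ 4 * (s ^ 0 * gam_density a s))"
    by (rule ext) (simp, algebra)
  ultimately show "has_bochner_integral lborel (\<lambda>s. (b * s - x) ^ 4 * gam_density a s)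
      (3 * x\<^sup>2 * b\<^sup>2 + 26 * x * b ^ 3 + 24 * b ^ 4)"
    by simp
qed

text \<open>Domination by twice the Gamma density. The order b is sharp enough, since this moment
  enters only the O(b) remainder of the variance.\<close>

lemma gam_min_density_second_moment:
  assumes "x > 0" "b > 0" and a: "a = x / b + 1"
  shows "integrable lborel (\<lambda>s. (b * s - x)\<^sup>2 * gam_min_density a s)"
    and "(\<integral>s. (b * s - x)\<^sup>2 * gam_min_density a s \<partial>lborel) \<le> 2 * (x * b + 2 * b\<^sup>2)"
proof -
  have apos: "a > 0"
    using assms by (simp add: add_pos_pos)
  note m = gam_density_central_moments(2)[OF assms]
  have le: "(b * s - x)\<^sup>2 * gam_min_density a s \<le> 2 * ((b * s - x)\<^sup>2 * gam_density a s)" for s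
    using mult_left_mono[OF gam_min_density_le[OF apos, of s], of "(b * s - x)\<^sup>2"] by simp
  have int2: "integrable lborel (\<lambda>s. 2 * ((b * s - x)\<^sup>2 * gam_density a s))"
    using m by (simp add: has_bochner_integral_iff)
  show int: "integrable lborel (\<lambda>s. (b * s - x)\<^sup>2 * gam_min_density a s)"
    by (rule Bochner_Integration.integrable_bound[OF int2])
      (use le apos in \<open>auto simp: gam_density_nonneg gam_min_density_nonneg abs_mult\<close>)
  have "(\<integral>s. (b * s - x)\<^sup>2 * gam_min_density a s \<partial>lborel)
      \<le> (\<integral>s. 2 * ((b * s - x)\<^sup>2 * gam_density a s) \<partial>lborel)"
    by (rule integral_mono[OF int int2 le])
  then show "(\<integral>s. (b * s - x)\<^sup>2 * gam_min_density a s \<partial>lborel) \<le> 2 * (x * b + 2 * b\<^sup>2)"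
    using has_bochner_integral_integral_eq[OF m] by simp
qed

text \<open>The exact mean is \<open>b - b * r / sqrt pi\<close> with \<open>r\<close> the Gamma
  quotient, and \<open>b * r\<close> lies between \<open>sqrt b * sqrt x\<close> and that value plus
  \<open>b\<close>. The two corrections have opposite signs and size at most \<open>b\<close>, so
  their sum is also at most \<open>b\<close> in absolute value.\<close>

lemma gam_min_density_first_moment_bounds:
  assumes "x > 0" "b > 0" and a: "a = x / b + 1"
  obtains \<mu> where "has_bochner_integral lborel (\<lambda>s. (b * s - x) * gam_min_density a s) \<mu>"
    and "\<bar>\<mu> + sqrt b * (sqrt x / sqrt pi)\<bar> \<le> b"
proof -
  have a1: "a > 1"
    using assms by simp
  have ab: "b * a = x + b"
    using assms by (simp add: field_simps)
  define r where "r = Gamma (a + 1 / 2) / Gamma a"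
  have "has_bochner_integral lborel
      (\<lambda>s. b * (s * gam_min_density a s) - x * gam_min_density a s)
      (b * (a - Gamma (a + 1 / 2) / (sqrt pi * Gamma a)) - x * 1)"
    by (intro has_bochner_integral_diff has_bochner_integral_mult_right
        gam_min_density_mean gam_min_density_has_integral a1)
  moreover have "b * (a - Gamma (a + 1 / 2) / (sqrt pi * Gamma a)) - x * 1 = b - b * r / sqrt pi"
    using ab by (simp add: r_def right_diff_distrib)
  moreover have "(\<lambda>s. b * (s * gam_min_density a s) - x * gam_min_density a s)
      = (\<lambda>s. (b * s - x) * gam_min_density a s)"
    by (simp add: algebra_simps)
  ultimately have 1: "has_bochner_integral lborel
      (\<lambda>s. (b * s - x) * gam_min_density a s) (b - b * r / sqrt pi)"
    by (simp only:)
  have "b * r \<le> b * sqrt a"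
    unfolding r_def using a1 \<open>b > 0\<close> by (intro mult_left_mono Gamma_half_ratio_bounds) auto
  also have "\<dots> = sqrt (b * x + b\<^sup>2)"
  proof -
    have "b * x + b\<^sup>2 = b\<^sup>2 * a"
      by (simp add: power2_eq_square mult.assoc ab distrib_left)
    then show ?thesis
      using \<open>b > 0\<close> by (simp add: real_sqrt_mult)
  qed
  also have "\<dots> \<le> sqrt (b * x) + sqrt (b\<^sup>2)"
    using assms by (intro sqrt_add_le_add_sqrt) auto
  finally have upper: "b * r \<le> sqrt b * sqrt x + b"
    using assms by (simp add: real_sqrt_mult)
  \<comment> \<open>The summand 1 in the shape outweighs the loss of 1/2 in the lower bound for the
    quotient, so \<open>b * x\<close> itself is a lower bound.\<close>
  have "b\<^sup>2 * (a - 1 / 2) = b * (b * a) - b\<^sup>2 / 2"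
    by (simp add: power2_eq_square algebra_simps)
  also have "\<dots> = b * x + b\<^sup>2 / 2"
    unfolding ab by (simp add: power2_eq_square algebra_simps)
  finally have "sqrt b * sqrt x \<le> sqrt (b\<^sup>2 * (a - 1 / 2))"
    unfolding real_sqrt_mult[symmetric] real_sqrt_le_iff by simp
  also have "\<dots> = b * sqrt (a - 1 / 2)"
    using assms by (simp add: real_sqrt_mult)
  also have "\<dots> \<le> b * r"
    unfolding r_def using a1 \<open>b > 0\<close> by (intro mult_left_mono Gamma_half_ratio_bounds) auto
  finally have lower: "sqrt b * sqrt x \<le> b * r" .
  have "1 \<le> sqrt pi"
    using pi_ge_two by simp
  then have "\<bar>b * r - sqrt b * sqrt x\<bar> / sqrt pi \<le> b / 1"
    using upper lower assms by (intro frac_le) auto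
  moreover have "0 \<le> (b * r - sqrt b * sqrt x) / sqrt pi"
    using lower by simp
  ultimately have "\<bar>(b - b * r / sqrt pi) + sqrt b * (sqrt x / sqrt pi)\<bar> \<le> b"
    using lower by (simp add: diff_divide_distrib)
  with 1 show ?thesis
    by (rule that)
qed

text \<open>Used with \<open>q\<close> a Taylor polynomial and \<open>r\<close> its error bound. The
  comparison on \<open>t >= 0\<close> carries over to the integrals because \<open>w\<close>
  vanishes on the negative half line.\<close>

lemma density_integral_approx:
  fixes w F q r :: "real \<Rightarrow> real"
  assumes w: "integrable lborel w" "\<And>s. 0 \<le> w s" "\<And>s. s < 0 \<Longrightarrow> w s = 0" and "b > 0"
    and F: "F \<in> borel_measurable borel" "\<And>t. \<bar>F t\<bar> \<le> 1"
    and q: "has_bochner_integral lborel (\<lambda>s. q (b * s) * w s) Q"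
    and r: "has_bochner_integral lborel (\<lambda>s. r (b * s) * w s) R"
    and approx: "\<And>t. t \<ge> 0 \<Longrightarrow> \<bar>F t - q t\<bar> \<le> r t"
  shows "\<bar>(\<integral>s. w s * F (b * s) \<partial>lborel) - Q\<bar> \<le> R"
proof -
  note [measurable] = F(1) borel_measurable_integrable[OF w(1)]
  have int: "integrable lborel (\<lambda>s. w s * F (b * s))"
    by (rule Bochner_Integration.integrable_bound[OF w(1)])
      (use w F in \<open>auto simp: abs_mult intro!: mult_left_le\<close>)
  have le: "\<bar>w s * F (b * s) - q (b * s) * w s\<bar> \<le> r (b * s) * w s" for s
  proof (cases "s \<ge> 0")
    case True
    have "w s * F (b * s) - q (b * s) * w s = (F (b * s) - q (b * s)) * w s"
      by (simp add: algebra_simps)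
    then have "\<bar>w s * F (b * s) - q (b * s) * w s\<bar> = \<bar>F (b * s) - q (b * s)\<bar> * w s"
      using w(2)[of s] by (simp only: abs_mult abs_of_nonneg)
    then show ?thesis
      using approx[of "b * s"] True \<open>b > 0\<close> w(2) by (auto intro!: mult_right_mono)
  qed (simp add: w)
  have "\<bar>(\<integral>s. w s * F (b * s) \<partial>lborel) - Q\<bar>
      = \<bar>\<integral>s. w s * F (b * s) - q (b * s) * w s \<partial>lborel\<bar>"
    using int q by (simp add: has_bochner_integral_iff)
  also have "\<dots> \<le> (\<integral>s. \<bar>w s * F (b * s) - q (b * s) * w s\<bar> \<partial>lborel)"
    by (rule integral_abs_bound)
  also have "\<dots> \<le> (\<integral>s. r (b * s) * w s \<partial>lborel)"
    using int q r le by (intro integral_mono) (auto simp: has_bochner_integral_iff)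
  finally show ?thesis
    using r by (simp add: has_bochner_integral_iff)
qed

text \<open>The analytic half of the argument: neither a sample nor a sample size occurs, so every
  constant found here depends on the fixed data alone.\<close>

locale smooth_cdf =
  fixes F f f' :: "real \<Rightarrow> real" and x L :: real
  assumes F_measurable: "F \<in> borel_measurable borel"
    and F_le_1: "\<And>t. \<bar>F t\<bar> \<le> 1"
    and F_deriv: "\<And>t. t \<ge> 0 \<Longrightarrow> (F has_real_derivative f t) (at t within {0..})"
    and f_deriv: "\<And>t. t \<ge> 0 \<Longrightarrow> (f has_real_derivative f' t) (at t within {0..})"
    and f'_bound: "\<And>t. t \<ge> 0 \<Longrightarrow> \<bar>f' t\<bar> \<le> L"
    and x_pos: "x > 0"
begin

definition kernel_mean :: "real \<Rightarrow> real" where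
  "kernel_mean b = (\<integral>s. gam_density (x / b + 1) s * F (b * s) \<partial>lborel)"

definition kernel_sqmean :: "real \<Rightarrow> real" where
  "kernel_sqmean b = (\<integral>s. gam_min_density (x / b + 1) s * F (b * s) \<partial>lborel)"

lemma L_nonneg: "L \<ge> 0"
  using f'_bound[of 0] by simp

lemma F_taylor: "t \<ge> 0 \<Longrightarrow> \<bar>F t - (F x + f x * (t - x))\<bar> \<le> L * (t - x)\<^sup>2"
  using taylor_quadratic_remainder[of "{0..}" x t L F f f'] F_deriv f_deriv f'_bound L_nonneg x_pos
  by (simp add: diff_diff_eq)

text \<open>Precise to O(b) only; it serves the variance, while the bias rests on the finer
  version.\<close>

lemma kernel_mean_crude:
  assumes "b > 0"
  shows "\<bar>kernel_mean b - (F x + f x * b)\<bar> \<le> L * (x * b + 2 * b\<^sup>2)"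
proof -
  define a where "a = x / b + 1"
  have a: "a > 0"
    using assms x_pos by (simp add: a_def add_pos_pos)
  note m = gam_density_central_moments[OF x_pos assms a_def]
  have "has_bochner_integral lborel (\<lambda>s. F x * gam_density a s + f x * ((b * s - x) * gam_density a s))
      (F x * 1 + f x * b)"
    by (intro has_bochner_integral_add has_bochner_integral_mult_right
        gam_density_has_integral m a)
  then have q: "has_bochner_integral lborel (\<lambda>s. (F x + f x * (b * s - x)) * gam_density a s)
      (F x + f x * b)"
    by (simp add: distrib_right mult.assoc)
  have r: "has_bochner_integral lborel (\<lambda>s. L * (b * s - x)\<^sup>2 * gam_density a s) (L * (x * b + 2 * b\<^sup>2))"
    using has_bochner_integral_mult_right[OF m(2), of L] by (simp add: mult.assoc)
  show ?thesis
    unfolding kernel_mean_def a_def[symmetric]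
    by (rule density_integral_approx[where q = "\<lambda>t. F x + f x * (t - x)" and r = "\<lambda>t. L * (t - x)\<^sup>2"])
      (use a assms q r F_measurable F_le_1 F_taylor in \<open>auto simp: gam_density_nonneg gam_density_eq_0\<close>)
qed

text \<open>\<open>K\<close> is chosen after \<epsilon> but before \<open>b\<close>. As b tends to 0
  the term with \<open>K\<close> is O(b^2), and what remains is \<epsilon> times a quantity of order
  b, with \<epsilon> arbitrary: this is o(b).\<close>

lemma kernel_mean_fine:
  assumes "\<epsilon> > 0"
  obtains K where "K \<ge> 0" and "\<And>b. b > 0 \<Longrightarrow>
    \<bar>kernel_mean b - (F x + f x * b + f' x / 2 * (x * b + 2 * b\<^sup>2))\<bar>
      \<le> \<epsilon> * (x * b + 2 * b\<^sup>2) + K * (3 * x\<^sup>2 * b\<^sup>2 + 26 * x * b ^ 3 + 24 * b ^ 4)"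
proof -
  obtain K where K: "K \<ge> 0" "\<And>t. t \<ge> 0 \<Longrightarrow>
      \<bar>F t - F x - f x * (t - x) - f' x / 2 * (t - x)\<^sup>2\<bar> \<le> \<epsilon> * (t - x)\<^sup>2 + K * (t - x) ^ 4"
    using taylor_quartic_remainder[of "{0..}" x L \<epsilon> F f f'] assms F_deriv f_deriv f'_bound
      L_nonneg x_pos
    by (auto simp: less_imp_le)
  show ?thesis
  proof (rule that[OF K(1)])
    fix b :: real assume b: "b > 0"
    define a where "a = x / b + 1"
    have a: "a > 0"
      using b x_pos by (simp add: a_def add_pos_pos)
    note m = gam_density_central_moments[OF x_pos b a_def]
    have "has_bochner_integral lborel (\<lambda>s. F x * gam_density a s
          + f x * ((b * s - x) * gam_density a s) + f' x / 2 * ((b * s - x)\<^sup>2 * gam_density a s))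
        (F x * 1 + f x * b + f' x / 2 * (x * b + 2 * b\<^sup>2))"
      by (intro has_bochner_integral_add has_bochner_integral_mult_right
          gam_density_has_integral m a)
    then have q: "has_bochner_integral lborel
        (\<lambda>s. (F x + f x * (b * s - x) + f' x / 2 * (b * s - x)\<^sup>2) * gam_density a s)
        (F x + f x * b + f' x / 2 * (x * b + 2 * b\<^sup>2))"
      by (simp add: distrib_right mult.assoc)
    have "has_bochner_integral lborel
        (\<lambda>s. \<epsilon> * ((b * s - x)\<^sup>2 * gam_density a s) + K * ((b * s - x) ^ 4 * gam_density a s))
        (\<epsilon> * (x * b + 2 * b\<^sup>2) + K * (3 * x\<^sup>2 * b\<^sup>2 + 26 * x * b ^ 3 + 24 * b ^ 4))"
      by (intro has_bochner_integral_add has_bochner_integral_mult_right m)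
    then have r: "has_bochner_integral lborel
        (\<lambda>s. (\<epsilon> * (b * s - x)\<^sup>2 + K * (b * s - x) ^ 4) * gam_density a s)
        (\<epsilon> * (x * b + 2 * b\<^sup>2) + K * (3 * x\<^sup>2 * b\<^sup>2 + 26 * x * b ^ 3 + 24 * b ^ 4))"
      by (simp add: distrib_right mult.assoc)
    show "\<bar>kernel_mean b - (F x + f x * b + f' x / 2 * (x * b + 2 * b\<^sup>2))\<bar>
        \<le> \<epsilon> * (x * b + 2 * b\<^sup>2) + K * (3 * x\<^sup>2 * b\<^sup>2 + 26 * x * b ^ 3 + 24 * b ^ 4)"
      unfolding kernel_mean_def a_def[symmetric]
      by (rule density_integral_approx[where
            q = "\<lambda>t. F x + f x * (t - x) + f' x / 2 * (t - x)\<^sup>2"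
            and r = "\<lambda>t. \<epsilon> * (t - x)\<^sup>2 + K * (t - x) ^ 4"])
        (use a b q r F_measurable F_le_1 K(2) in
          \<open>auto simp: gam_density_nonneg gam_density_eq_0 diff_diff_eq\<close>)
  qed
qed

lemma kernel_sqmean_crude:
  assumes "b > 0"
  shows "\<bar>kernel_sqmean b - (F x - sqrt b * (sqrt x * f x / sqrt pi))\<bar>
    \<le> \<bar>f x\<bar> * b + L * (2 * (x * b + 2 * b\<^sup>2))"
proof -
  define a where "a = x / b + 1"
  have a: "a > 1"
    using assms x_pos by (simp add: a_def)
  note m2 = gam_min_density_second_moment[OF x_pos assms a_def]
  obtain \<mu> where \<mu>: "has_bochner_integral lborel (\<lambda>s. (b * s - x) * gam_min_density a s) \<mu>"
    "\<bar>\<mu> + sqrt b * (sqrt x / sqrt pi)\<bar> \<le> b"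
    by (rule gam_min_density_first_moment_bounds[OF x_pos assms a_def])
  have "has_bochner_integral lborel
      (\<lambda>s. F x * gam_min_density a s + f x * ((b * s - x) * gam_min_density a s))
      (F x * 1 + f x * \<mu>)"
    by (intro has_bochner_integral_add has_bochner_integral_mult_right
        gam_min_density_has_integral \<mu> a)
  then have q: "has_bochner_integral lborel (\<lambda>s. (F x + f x * (b * s - x)) * gam_min_density a s)
      (F x + f x * \<mu>)"
    by (simp add: distrib_right mult.assoc)
  have r: "has_bochner_integral lborel (\<lambda>s. L * (b * s - x)\<^sup>2 * gam_min_density a s)
      (L * (\<integral>s. (b * s - x)\<^sup>2 * gam_min_density a s \<partial>lborel))"
    using has_bochner_integral_mult_right[OF has_bochner_integral_integrable[OF m2(1)], of L]
    by (simp add: mult.assoc)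
  have "\<bar>kernel_sqmean b - (F x + f x * \<mu>)\<bar>
      \<le> L * (\<integral>s. (b * s - x)\<^sup>2 * gam_min_density a s \<partial>lborel)"
    unfolding kernel_sqmean_def a_def[symmetric]
    by (rule density_integral_approx[where q = "\<lambda>t. F x + f x * (t - x)" and r = "\<lambda>t. L * (t - x)\<^sup>2"])
      (use a assms q r F_measurable F_le_1 F_taylor gam_min_density_has_integral[OF a] in
        \<open>auto simp: gam_min_density_nonneg gam_min_density_eq_0 has_bochner_integral_iff\<close>)
  also have "\<dots> \<le> L * (2 * (x * b + 2 * b\<^sup>2))"
    by (rule mult_left_mono[OF m2(2) L_nonneg])
  finally have 1: "\<bar>kernel_sqmean b - (F x + f x * \<mu>)\<bar> \<le> L * (2 * (x * b + 2 * b\<^sup>2))" .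
  have "\<bar>f x * \<mu> + sqrt b * (sqrt x * f x / sqrt pi)\<bar>
      = \<bar>f x\<bar> * \<bar>\<mu> + sqrt b * (sqrt x / sqrt pi)\<bar>"
    by (simp add: abs_mult [symmetric] algebra_simps)
  also have "\<dots> \<le> \<bar>f x\<bar> * b"
    using \<mu>(2) by (intro mult_left_mono) auto
  finally show ?thesis
    using 1 by linarith
qed

lemma kernel_variance_expansion:
  obtains C where "\<And>b. 0 < b \<Longrightarrow> b \<le> 1 \<Longrightarrow>
    \<bar>kernel_sqmean b - (kernel_mean b)\<^sup>2
      - (F x * (1 - F x) - sqrt b * (sqrt x * f x / sqrt pi))\<bar> \<le> C * b"
proof (rule that)
  \<comment> \<open>For \<open>b <= 1\<close> all squares of \<open>b\<close> are absorbed, so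
    \<open>D * b\<close> bounds the error of the mean and \<open>2 * D * b\<close> that of the
    second moment. The squares of the mean and of \<open>F x\<close> are compared through difference
    times sum, the sum being at most \<open>2 + D\<close>.\<close>
  define D where "D = \<bar>f x\<bar> + L * (x + 2)"
  have D: "D \<ge> 0"
    using L_nonneg x_pos by (simp add: D_def)
  fix b :: real assume b: "0 < b" "b \<le> 1"
  have "b\<^sup>2 \<le> b"
    using b by (simp add: power2_eq_square mult_left_le)
  then have le: "L * (x * b + 2 * b\<^sup>2) \<le> L * (x + 2) * b"
    unfolding mult.assoc using L_nonneg by (intro mult_left_mono) (auto simp: algebra_simps)
  have mean: "\<bar>kernel_mean b - F x\<bar> \<le> D * b"
  proof -
    have "\<bar>f x * b\<bar> = \<bar>f x\<bar> * b"
      using b by (simp add: abs_mult)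
    then show ?thesis
      using kernel_mean_crude[OF b(1)] le unfolding D_def distrib_right by linarith
  qed
  have "D * b \<le> D"
    using D b by (simp add: mult_left_le)
  then have "\<bar>kernel_mean b + F x\<bar> \<le> 2 + D"
    using mean F_le_1[of x] by linarith
  then have "\<bar>kernel_mean b - F x\<bar> * \<bar>kernel_mean b + F x\<bar> \<le> D * b * (2 + D)"
    using mean by (intro mult_mono) auto
  then have "\<bar>(kernel_mean b)\<^sup>2 - (F x)\<^sup>2\<bar> \<le> D * (2 + D) * b"
    by (simp add: abs_mult [symmetric] power2_eq_square algebra_simps)
  moreover have "\<bar>kernel_sqmean b - (F x - sqrt b * (sqrt x * f x / sqrt pi))\<bar> \<le> 2 * D * b"
  proof -
    have "\<bar>f x\<bar> * b \<ge> 0"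
      using b by simp
    then show ?thesis
      using kernel_sqmean_crude[OF b(1)] le unfolding D_def distrib_right distrib_left by linarith
  qed
  ultimately show "\<bar>kernel_sqmean b - (kernel_mean b)\<^sup>2
      - (F x * (1 - F x) - sqrt b * (sqrt x * f x / sqrt pi))\<bar> \<le> (D * (2 + D) + 2 * D) * b"
    unfolding distrib_right[of _ _ b] by (simp add: algebra_simps power2_eq_square)
qed

lemma kernel_bias_expansion:
  "(\<lambda>b. kernel_mean b - F x - b * (f x + x / 2 * f' x)) \<in> o[at_right 0](\<lambda>b. b)"
proof (rule landau_o.smallI)
  fix c :: real assume c: "c > 0"
  \<comment> \<open>For \<open>b <= 1\<close> the second moment is at most
    \<open>(x + 2) * b\<close>, so this choice spends half of the allowed error
    \<open>c * b\<close>.\<close>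
  define \<epsilon> where "\<epsilon> = c / 2 / (x + 2)"
  have "x + 2 \<noteq> 0" "x + 2 > 0"
    using x_pos by simp_all
  then have \<epsilon>: "\<epsilon> > 0" "\<epsilon> * (x + 2) = c / 2"
    using c by (simp_all add: \<epsilon>_def del: divide_divide_eq_left)
  obtain K where K: "K \<ge> 0" "\<And>b. b > 0 \<Longrightarrow>
      \<bar>kernel_mean b - (F x + f x * b + f' x / 2 * (x * b + 2 * b\<^sup>2))\<bar>
      \<le> \<epsilon> * (x * b + 2 * b\<^sup>2) + K * (3 * x\<^sup>2 * b\<^sup>2 + 26 * x * b ^ 3 + 24 * b ^ 4)"
    using kernel_mean_fine[OF \<epsilon>(1)] by blast
  \<comment> \<open>Collects all contributions of order b^2: the fourth moment, and the term
    \<open>f' x * b^2\<close> left over because the second moment is \<open>x * b + 2 * b^2\<close>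
    and not \<open>x * b\<close>.\<close>
  define N where "N = \<bar>f' x\<bar> + K * (3 * x\<^sup>2 + 26 * x + 24)"
  have N: "N \<ge> 0"
    using K(1) x_pos by (simp add: N_def)
  \<comment> \<open>Below \<open>d\<close> these contributions take at most the other half of
    \<open>c * b\<close>; \<open>N + 1\<close> keeps the denominator positive when
    \<open>N = 0\<close>.\<close>
  define d where "d = min 1 (c / (2 * (N + 1)))"
  have d: "d > 0"
    using c N by (simp add: d_def)
  have bound: "\<bar>kernel_mean b - F x - b * (f x + x / 2 * f' x)\<bar> \<le> c * b" if b: "0 < b" "b < d" for b
  proof -
    have b1: "b \<le> 1" and bN: "b \<le> c / (2 * (N + 1))"
      using b by (auto simp: d_def)
    have "b * N \<le> b * (N + 1)"
      using b by simp
    also have "\<dots> \<le> c / 2"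
      using bN N by (simp add: field_simps)
    finally have "b * (b * N) \<le> b * (c / 2)"
      using b by (intro mult_left_mono) auto
    then have Nb: "N * b\<^sup>2 \<le> c / 2 * b"
      by (simp add: power2_eq_square mult_ac)
    have pw: "b\<^sup>2 \<le> b" "b ^ 3 \<le> b\<^sup>2" "b ^ 4 \<le> b\<^sup>2"
      using b b1 power_decreasing[of 1 2 b] power_decreasing[of 2 3 b] power_decreasing[of 2 4 b]
      by auto
    have "\<epsilon> * (x * b + 2 * b\<^sup>2) \<le> \<epsilon> * ((x + 2) * b)"
      using \<epsilon> pw by (intro mult_left_mono) (auto simp: algebra_simps)
    also have "\<dots> = c / 2 * b"
      using \<epsilon>(2) by (metis mult.assoc)
    finally have 1: "\<epsilon> * (x * b + 2 * b\<^sup>2) \<le> c / 2 * b" .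
    have "3 * x\<^sup>2 * b\<^sup>2 + 26 * x * b ^ 3 + 24 * b ^ 4 \<le> 3 * x\<^sup>2 * b\<^sup>2 + 26 * x * b\<^sup>2 + 24 * b\<^sup>2"
      using pw x_pos by (intro add_mono mult_left_mono) auto
    then have "K * (3 * x\<^sup>2 * b\<^sup>2 + 26 * x * b ^ 3 + 24 * b ^ 4)
        \<le> K * ((3 * x\<^sup>2 + 26 * x + 24) * b\<^sup>2)"
      using K(1) by (intro mult_left_mono) (auto simp: algebra_simps)
    then have 2: "K * (3 * x\<^sup>2 * b\<^sup>2 + 26 * x * b ^ 3 + 24 * b ^ 4) + \<bar>f' x\<bar> * b\<^sup>2 \<le> N * b\<^sup>2"
      by (simp add: N_def algebra_simps)
    have "kernel_mean b - F x - b * (f x + x / 2 * f' x)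
        = kernel_mean b - (F x + f x * b + f' x / 2 * (x * b + 2 * b\<^sup>2)) + f' x * b\<^sup>2"
      by (simp add: algebra_simps)
    moreover have "\<bar>f' x * b\<^sup>2\<bar> = \<bar>f' x\<bar> * b\<^sup>2"
      by (simp add: abs_mult)
    ultimately show ?thesis
      using K(2)[OF b(1)] 1 2 Nb by linarith
  qed
  then have "\<forall>b>0. b < d \<longrightarrow> norm (kernel_mean b - F x - b * (f x + x / 2 * f' x)) \<le> c * norm b"
    by simp
  with d show "\<forall>\<^sub>F b in at_right 0. norm (kernel_mean b - F x - b * (f x + x / 2 * f' x)) \<le> c * norm b"
    by (auto simp: eventually_at_right_field)
qed

text \<open>Writing the bias as \<open>b * B + e b\<close>, the difference of squares is
  \<open>e b * (2 * B * b + e b)\<close>, a product of o(b) and O(b).\<close>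

lemma kernel_square_bias_expansion:
  "(\<lambda>b. (kernel_mean b - F x)\<^sup>2 - b\<^sup>2 * (f x + x / 2 * f' x)\<^sup>2) \<in> o[at_right 0](\<lambda>b. b\<^sup>2)"
proof -
  define B where "B = f x + x / 2 * f' x"
  define e where "e b = kernel_mean b - F x - b * B" for b
  have e: "e \<in> o[at_right 0](\<lambda>b. b)"
    using kernel_bias_expansion by (simp add: e_def[abs_def] B_def)
  have "(\<lambda>b. 2 * B * b + e b) \<in> O[at_right 0](\<lambda>b. b)"
    by (intro sum_in_bigo landau_o.small_imp_big[OF e]) simp
  then have "(\<lambda>b. e b * (2 * B * b + e b)) \<in> o[at_right 0](\<lambda>b. b * b)"
    by (rule landau_o.small_big_mult[OF e])
  moreover have "e b * (2 * B * b + e b) = (kernel_mean b - F x)\<^sup>2 - b\<^sup>2 * B\<^sup>2" for b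
    by (simp add: e_def power2_eq_square algebra_simps)
  ultimately show ?thesis
    by (simp add: B_def power2_eq_square)
qed

end

section \<open>Mean squared error\<close>

lemma (in prob_space) mse_eq_variance_plus_bias_squared:
  assumes [simp]: "integrable M Y" "integrable M (\<lambda>\<omega>. (Y \<omega>)\<^sup>2)"
  shows "mse M Y \<theta> = variance Y + (bias M Y \<theta>)\<^sup>2"
proof -
  have "mse M Y \<theta> = expectation (\<lambda>\<omega>. (Y \<omega>)\<^sup>2 - 2 * \<theta> * Y \<omega> + \<theta>\<^sup>2)"
    unfolding mse_def by (simp add: power2_diff algebra_simps)
  also have "\<dots> = expectation (\<lambda>\<omega>. (Y \<omega>)\<^sup>2) - 2 * \<theta> * expectation Y + \<theta>\<^sup>2"
    by (simp add: prob_space)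
  finally show ?thesis
    unfolding variance_eq[OF assms] bias_def by (simp add: power2_diff algebra_simps)
qed

lemma (in prob_space) mean_of_iid_moments:
  fixes Y :: "nat \<Rightarrow> 'a \<Rightarrow> real"
  assumes indep: "indep_vars (\<lambda>_. borel) Y {1..n}"
    and int: "\<And>i. i \<in> {1..n} \<Longrightarrow> integrable M (Y i)"
    and int2: "\<And>i. i \<in> {1..n} \<Longrightarrow> integrable M (\<lambda>\<omega>. (Y i \<omega>)\<^sup>2)"
    and m: "\<And>i. i \<in> {1..n} \<Longrightarrow> expectation (Y i) = m"
    and v: "\<And>i. i \<in> {1..n} \<Longrightarrow> expectation (\<lambda>\<omega>. (Y i \<omega>)\<^sup>2) = v"
    and "n \<ge> 1"
  defines "A \<equiv> \<lambda>\<omega>. 1 / real n * (\<Sum>i=1..n. Y i \<omega>)"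
  shows "integrable M A" "integrable M (\<lambda>\<omega>. (A \<omega>)\<^sup>2)" "expectation A = m"
    and "variance A = (v - m\<^sup>2) / real n"
proof -
  show intA: "integrable M A"
    unfolding A_def by (intro integrable_mult_right Bochner_Integration.integrable_sum int)
  show EA: "expectation A = m"
    using \<open>n \<ge> 1\<close> int m by (simp add: A_def)
  \<comment> \<open>Centring makes the mixed products in the expanded square have mean 0, so only
    the diagonal of the double sum survives.\<close>
  define Z where "Z i \<omega> = Y i \<omega> - m" for i \<omega>
  have indepZ: "indep_vars (\<lambda>_. borel) Z {1..n}"
    unfolding Z_def by (rule indep_vars_compose2[OF indep]) auto
  have Z: "integrable M (Z i)" "expectation (Z i) = 0" "integrable M (\<lambda>\<omega>. Z i \<omega> * Z i \<omega>)"
    "expectation (\<lambda>\<omega>. Z i \<omega> * Z i \<omega>) = v - m\<^sup>2" if i: "i \<in> {1..n}" for i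
  proof -
    note [simp] = int[OF i] int2[OF i] m[OF i] v[OF i]
    show "integrable M (Z i)" "expectation (Z i) = 0"
      by (simp_all add: Z_def[abs_def] prob_space)
    have eq: "(\<lambda>\<omega>. Z i \<omega> * Z i \<omega>) = (\<lambda>\<omega>. (Y i \<omega>)\<^sup>2 - 2 * m * Y i \<omega> + m\<^sup>2)"
      by (simp add: Z_def power2_eq_square algebra_simps)
    show "integrable M (\<lambda>\<omega>. Z i \<omega> * Z i \<omega>)"
      unfolding eq by simp
    show "expectation (\<lambda>\<omega>. Z i \<omega> * Z i \<omega>) = v - m\<^sup>2"
    proof -
      have "expectation (\<lambda>\<omega>. (Y i \<omega>)\<^sup>2 - 2 * m * Y i \<omega> + m\<^sup>2) = v - 2 * m * m + m\<^sup>2"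
        by (simp add: prob_space)
      then show ?thesis
        unfolding eq by (simp add: power2_eq_square)
    qed
  qed
  have ZZ: "integrable M (\<lambda>\<omega>. Z i \<omega> * Z j \<omega>)" "expectation (\<lambda>\<omega>. Z i \<omega> * Z j \<omega>) = 0"
    if ij: "i \<in> {1..n}" "j \<in> {1..n}" "i \<noteq> j" for i j
  proof -
    have ind: "indep_vars (\<lambda>_. borel) Z {i, j}"
      by (rule indep_vars_subset[OF indepZ]) (use ij in auto)
    have intk: "integrable M (Z k)" if "k \<in> {i, j}" for k
      using that ij Z(1) by auto
    show "integrable M (\<lambda>\<omega>. Z i \<omega> * Z j \<omega>)"
      using indep_vars_integrable[OF _ ind intk] ij by simp
    show "expectation (\<lambda>\<omega>. Z i \<omega> * Z j \<omega>) = 0"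
      using indep_vars_lebesgue_integral[OF _ ind intk] ij Z(2) by simp
  qed
  have intZZ: "integrable M (\<lambda>\<omega>. Z i \<omega> * Z j \<omega>)" if "i \<in> {1..n}" "j \<in> {1..n}" for i j
    using that Z(3) ZZ(1) by (cases "i = j") auto
  have "(\<Sum>i=1..n. Z i \<omega>) = real n * (A \<omega> - m)" for \<omega>
    using \<open>n \<ge> 1\<close> by (simp add: A_def Z_def sum_subtractf right_diff_distrib)
  then have "A \<omega> - m = (\<Sum>i=1..n. Z i \<omega>) / real n" for \<omega>
    using \<open>n \<ge> 1\<close> by simp
  then have sq: "(A \<omega> - m)\<^sup>2 = (\<Sum>i=1..n. \<Sum>j=1..n. Z i \<omega> * Z j \<omega>) / (real n)\<^sup>2" for \<omega>
    by (simp add: power_divide power2_eq_square sum_product)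
  have "integrable M (\<lambda>\<omega>. (A \<omega> - m)\<^sup>2)"
    unfolding sq
    by (intro integrable_divide Bochner_Integration.integrable_sum intZZ)
  then have "integrable M (\<lambda>\<omega>. (A \<omega> - m)\<^sup>2 + 2 * m * A \<omega> - m\<^sup>2)"
    using intA by simp
  then show "integrable M (\<lambda>\<omega>. (A \<omega>)\<^sup>2)"
    by (simp add: power2_eq_square algebra_simps)
  have "variance A = expectation (\<lambda>\<omega>. (\<Sum>i=1..n. \<Sum>j=1..n. Z i \<omega> * Z j \<omega>) / (real n)\<^sup>2)"
    by (simp only: EA sq)
  also have "\<dots> = (\<Sum>i=1..n. \<Sum>j=1..n. expectation (\<lambda>\<omega>. Z i \<omega> * Z j \<omega>)) / (real n)\<^sup>2"
  proof -
    have "expectation (\<lambda>\<omega>. \<Sum>i=1..n. \<Sum>j=1..n. Z i \<omega> * Z j \<omega>)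
        = (\<Sum>i=1..n. expectation (\<lambda>\<omega>. \<Sum>j=1..n. Z i \<omega> * Z j \<omega>))"
      by (intro Bochner_Integration.integral_sum Bochner_Integration.integrable_sum intZZ)
    also have "\<dots> = (\<Sum>i=1..n. \<Sum>j=1..n. expectation (\<lambda>\<omega>. Z i \<omega> * Z j \<omega>))"
      by (intro sum.cong refl Bochner_Integration.integral_sum intZZ)
    finally show ?thesis
      by simp
  qed
  also have "(\<Sum>i=1..n. \<Sum>j=1..n. expectation (\<lambda>\<omega>. Z i \<omega> * Z j \<omega>))
      = (\<Sum>i=1..n. \<Sum>j=1..n. if i = j then v - m\<^sup>2 else 0)"
    by (intro sum.cong refl) (simp add: Z(4) ZZ(2))
  also have "\<dots> = real n * (v - m\<^sup>2)"
    by simp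
  finally show "variance A = (v - m\<^sup>2) / real n"
    using \<open>n \<ge> 1\<close> by (simp add: power2_eq_square)
qed

text \<open>With \<open>u = sqrt b\<close> the truncated expansion becomes the quartic
  \<open>c - u * A / N + B * u ^ 4\<close>, whose derivative vanishes exactly when
  \<open>4 * B * N * u ^ 3 = A\<close>. The explicit form of \<open>u\<close> is for the minimal
  value.\<close>

lemma cubic_critical_point:
  fixes A B N :: real
  assumes "A > 0" "B > 0" "N > 0"
  defines "u \<equiv> sqrt (N powr (- 2 / 3) * (4 * B / A) powr (- 2 / 3))"
  shows "u > 0" and "4 * B * N * u ^ 3 = A" and "u = N powr (- 1 / 3) * (A / (4 * B)) powr (1 / 3)"
proof -
  have "u = (N * (4 * B / A)) powr (- 1 / 3)"
    using assms by (simp add: u_def powr_mult [symmetric] powr_half_sqrt [symmetric] powr_powr)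
  moreover have "(4 * B / A) powr (- 1 / 3) = (A / (4 * B)) powr (1 / 3)"
    using assms(1-3) by (simp add: powr_minus powr_divide)
  ultimately show u: "u = N powr (- 1 / 3) * (A / (4 * B)) powr (1 / 3)"
    using assms(1-3) by (simp add: powr_mult times_divide_eq_right [symmetric] del: times_divide_eq_right)
  then show "u > 0"
    using assms(1-3) by simp
  have "u ^ 3 = N powr (- 1) * (A / (4 * B)) powr 1"
    unfolding u using assms(1-3) by (simp add: power_mult_distrib powr_power)
  then show "4 * B * N * u ^ 3 = A"
    using assms(1-3) by (simp add: powr_minus field_simps)
qed

lemma sqrt_quadratic_unique_minimizer:
  fixes c A B N :: real
  assumes "A > 0" "B > 0" "N > 0"
  defines "g \<equiv> \<lambda>b. c - 1 / N * sqrt b * A + b\<^sup>2 * B"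
    and "b0 \<equiv> N powr (- 2 / 3) * (4 * B / A) powr (- 2 / 3)"
  shows "is_arg_min g (\<lambda>b. b > 0) b \<longleftrightarrow> b = b0"
    and "g b0 = c - N powr (- 4 / 3) * (3 / 4) * (A ^ 4 / (4 * B)) powr (1 / 3)"
proof -
  define u where "u = sqrt b0"
  note u = cubic_critical_point[OF assms(1-3), folded b0_def u_def]
  have b0: "b0 > 0" "b0 = u\<^sup>2"
    using assms by (auto simp: b0_def u_def)
  have A: "A = 4 * B * N * u ^ 3"
    by (rule u(2)[symmetric])
  \<comment> \<open>Substituting \<open>A = 4 * B * N * u ^ 3\<close>, the excess is
    \<open>B\<close> times \<open>s ^ 4 - 4 * u ^ 3 * s + 3 * u ^ 4\<close> with
    \<open>s = sqrt b\<close>, which has the double root \<open>u\<close> and a positive cofactor.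
    This gives global minimality and uniqueness at once, without derivatives.\<close>
  have diff: "g b - g b0 = B * ((sqrt b - u)\<^sup>2 * ((sqrt b + u)\<^sup>2 + 2 * u\<^sup>2))" if "b > 0" for b
  proof -
    have "b\<^sup>2 = sqrt b ^ 4"
      using that by (simp add: power4_eq_xxxx power2_eq_square)
    moreover have "b0\<^sup>2 = u ^ 4"
      by (simp add: b0 power4_eq_xxxx power2_eq_square)
    moreover have "1 / N * s * A = 4 * B * u ^ 3 * s" for s
      using \<open>N > 0\<close> by (subst A) simp
    ultimately have "g b - g b0 = - 4 * B * u ^ 3 * sqrt b + sqrt b ^ 4 * B + 4 * B * u ^ 3 * u - u ^ 4 * B"
      by (simp add: g_def u_def[symmetric])
    then show ?thesis
      by algebra
  qed
  have strict: "g b0 < g b" if "b > 0" "b \<noteq> b0" for b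
  proof -
    have "sqrt b \<noteq> u"
      using that by (simp add: u_def)
    then have "0 < g b - g b0"
      using diff[OF that(1)] u(1) \<open>B > 0\<close> by (auto intro!: mult_pos_pos add_nonneg_pos)
    then show ?thesis
      by simp
  qed
  show "is_arg_min g (\<lambda>b. b > 0) b \<longleftrightarrow> b = b0"
  proof
    assume "is_arg_min g (\<lambda>b. b > 0) b"
    then have "b > 0" "\<not> g b0 < g b"
      using b0(1) by (auto simp: is_arg_min_def)
    then show "b = b0"
      using strict by blast
  qed (use strict b0(1) in \<open>force simp: is_arg_min_def\<close>)
  have AN: "A / N = 4 * B * u ^ 3"
    using A \<open>N > 0\<close> by (simp add: field_simps)
  \<comment> \<open>At the critical point the squared-bias term is a quarter of the variance gain,
    whence the factor \<open>3 / 4\<close>.\<close>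
  have "b0\<^sup>2 * B = u * (A / N) / 4"
    unfolding AN by (simp add: b0(2) power2_eq_square power3_eq_cube)
  then have "g b0 = c - 3 / 4 * (u * (A / N))"
    by (simp add: g_def u_def[symmetric])
  also have "u * (A / N) = N powr (- 4 / 3) * (A ^ 4 / (4 * B)) powr (1 / 3)"
  proof -
    have "N powr (- 4 / 3) = N powr (- 1 / 3) / N"
      using \<open>N > 0\<close> powr_diff[of N "- 1 / 3" 1] by simp
    moreover have "(A ^ 4 / (4 * B)) powr (1 / 3) = (A ^ 3) powr (1 / 3) * (A / (4 * B)) powr (1 / 3)"
    proof -
      have "A ^ 4 / (4 * B) = A ^ 3 * (A / (4 * B))"
        by (simp add: power4_eq_xxxx power3_eq_cube)
      then show ?thesis
        using assms(1,2) by (simp only: powr_mult)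
    qed
    moreover have "(A ^ 3) powr (1 / 3) = A"
    proof -
      have "(A ^ 3) powr (1 / 3) = (A powr 3) powr (1 / 3)"
        using assms(1) by simp
      then show ?thesis
        unfolding powr_powr using assms(1) by simp
    qed
    ultimately show ?thesis
      unfolding u(3) by simp
  qed
  finally show "g b0 = c - N powr (- 4 / 3) * (3 / 4) * (A ^ 4 / (4 * B)) powr (1 / 3)"
    by simp
qed

theorem corollary4p2:
  fixes M :: "'a measure"
    and X :: "nat \<Rightarrow> 'a \<Rightarrow> real"
    and F f f' :: "real \<Rightarrow> real"
    and x :: real
  assumes "prob_space M"
    and "prob_space.indep_vars M (\<lambda>_. borel) X {1..}"
    and "\<And>i. i \<ge> 1 \<Longrightarrow> cdf (distr M borel (X i)) = F"
    and "\<And>t. t < 0 \<Longrightarrow> F t = 0"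
    and "\<And>t. t \<ge> 0 \<Longrightarrow> (F has_real_derivative f t) (at t within {0..})"
    and "\<And>t. t \<ge> 0 \<Longrightarrow> (f has_real_derivative f' t) (at t within {0..})"
    and "continuous_on {0..} f" and "bounded (f ` {0..})"
    and "continuous_on {0..} f'" and "bounded (f' ` {0..})"
    and "x > 0"
  shows "(\<exists>C. \<forall>b :: nat \<Rightarrow> real. (\<forall>n\<ge>1. b n > 0) \<and> b \<longlonglongrightarrow> 0 \<longrightarrow>
           (\<forall>n\<ge>1. mse M (Gam_cdf_estimator X n (b n) x) (F x) =
                    prob_space.variance M (Gam_cdf_estimator X n (b n) x)
                    + (bias M (Gam_cdf_estimator X n (b n) x) (F x))\<^sup>2) \<and>
           (\<exists>R\<^sub>1 R\<^sub>2 :: nat \<Rightarrow> real.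
              (\<forall>n\<ge>1. mse M (Gam_cdf_estimator X n (b n) x) (F x) =
                       Gam_amse F f f' x n (b n) + R\<^sub>1 n + R\<^sub>2 n) \<and>
              (\<forall>\<^sub>F n in sequentially. \<bar>R\<^sub>1 n\<bar> \<le> C * (1 / real n * b n)) \<and>
              R\<^sub>2 \<in> o(\<lambda>n. (b n)\<^sup>2))) \<and>
         (f x * (f x + x / 2 * f' x) \<noteq> 0 \<longrightarrow>
           (\<forall>n\<ge>1. \<forall>b. is_arg_min (Gam_amse F f f' x n) (\<lambda>b. b > 0) b \<longleftrightarrow> b = Gam_bopt f f' x n) \<and>
           (\<lambda>n. mse M (Gam_cdf_estimator X n (Gam_bopt f f' x n) x) (F x)
                - (1 / real n * (F x * (1 - F x))
                   - real n powr (- 4 / 3) * (3 / 4)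
                     * ((sqrt x * f x / sqrt pi) ^ 4 / (4 * (f x + x / 2 * f' x)\<^sup>2)) powr (1 / 3)))
             \<in> o(\<lambda>n. real n powr (- 4 / 3)))"
proof -
  interpret prob_space M
    by fact
  have X [measurable]: "X i \<in> borel_measurable M" if "i \<ge> 1" for i
    using assms(2) that by (auto simp: indep_vars_def)
  have P: "real_distribution (distr M borel (X i))" if "i \<ge> 1" for i
    using X[OF that] by (rule real_distribution_distr)
  interpret P1: real_distribution "distr M borel (X 1)"
    by (rule P) simp
  have F_cdf: "F = cdf (distr M borel (X 1))"
    using assms(3)[of 1] by simp
  have F_mono: "mono F"
    unfolding F_cdf by (intro monoI P1.cdf_nondecreasing)
  obtain L where L: "\<And>t. t \<ge> 0 \<Longrightarrow> \<bar>f' t\<bar> \<le> L"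
    using assms(10) by (auto simp: bounded_iff)
  interpret smooth_cdf F f f' x L
  proof
    show "F \<in> borel_measurable borel"
      using F_mono by (rule borel_measurable_mono)
    show "\<bar>F t\<bar> \<le> 1" for t
      unfolding F_cdf using P1.cdf_nonneg[of t] P1.cdf_bounded_prob[of t] by simp
  qed (use assms L in auto)

  define A where "A = sqrt x * f x / sqrt pi"
  define B where "B = (f x + x / 2 * f' x)\<^sup>2"

  \<comment> \<open>Moments of the estimator for fixed sample size and bandwidth\<close>
  have est: "integrable M (Gam_cdf_estimator X n b x)"
    "integrable M (\<lambda>\<omega>. (Gam_cdf_estimator X n b x \<omega>)\<^sup>2)"
    "expectation (Gam_cdf_estimator X n b x) = kernel_mean b"
    "variance (Gam_cdf_estimator X n b x) = (kernel_sqmean b - (kernel_mean b)\<^sup>2) / real n"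
    if "n \<ge> 1" "b > 0" for n b
  proof -
    define a where "a = x / b + 1"
    have a: "a > 1"
      using \<open>b > 0\<close> \<open>x > 0\<close> by (simp add: a_def)
    have Y: "integrable M (\<lambda>\<omega>. Gam_kernel (X i \<omega>) a b)"
      "integrable M (\<lambda>\<omega>. (Gam_kernel (X i \<omega>) a b)\<^sup>2)"
      "expectation (\<lambda>\<omega>. Gam_kernel (X i \<omega>) a b) = kernel_mean b"
      "expectation (\<lambda>\<omega>. (Gam_kernel (X i \<omega>) a b)\<^sup>2) = kernel_sqmean b"
      if "i \<in> {1..n}" for i
    proof -
      have i: "i \<ge> 1"
        using that by simp
      note [measurable] = X[OF i]
      interpret Pi: real_distribution "distr M borel (X i)"
        by (rule P[OF i])
      have cdf_neg: "cdf (distr M borel (X i)) t = 0" if "t < 0" for t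
        using assms(3)[OF i] assms(4)[OF that] by simp
      \<comment> \<open>The bound is only almost sure, since the kernel is controlled at nonnegative
        data; it suffices for integrability.\<close>
      have AE: "AE \<omega> in M. 0 \<le> Gam_kernel (X i \<omega>) a b \<and> Gam_kernel (X i \<omega>) a b \<le> 1"
        using Pi.Gam_kernel_moments(1)[OF _ a \<open>b > 0\<close>] cdf_neg by (subst (asm) AE_distr_iff) auto
      show "integrable M (\<lambda>\<omega>. Gam_kernel (X i \<omega>) a b)"
        by (rule integrable_const_bound[of _ 1]) (use AE in auto)
      show "integrable M (\<lambda>\<omega>. (Gam_kernel (X i \<omega>) a b)\<^sup>2)"
        by (rule integrable_const_bound[of _ 1])
          (use AE in \<open>auto simp: power_le_one intro: AE_mp[OF AE]\<close>)
      show "expectation (\<lambda>\<omega>. Gam_kernel (X i \<omega>) a b) = kernel_mean b"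
        using Pi.Gam_kernel_moments(2)[OF _ a \<open>b > 0\<close>] cdf_neg assms(3)[OF i]
        by (simp add: integral_distr kernel_mean_def a_def)
      show "expectation (\<lambda>\<omega>. (Gam_kernel (X i \<omega>) a b)\<^sup>2) = kernel_sqmean b"
        using Pi.Gam_kernel_moments(3)[OF _ a \<open>b > 0\<close>] cdf_neg assms(3)[OF i]
        by (simp add: integral_distr kernel_sqmean_def a_def)
    qed
    have indep: "indep_vars (\<lambda>_. borel) (\<lambda>i \<omega>. Gam_kernel (X i \<omega>) a b) {1..n}"
      by (rule indep_vars_compose2[OF indep_vars_subset[OF assms(2)]]) auto
    have eq: "Gam_cdf_estimator X n b x = (\<lambda>\<omega>. 1 / real n * (\<Sum>i=1..n. Gam_kernel (X i \<omega>) a b))"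
      by (simp add: fun_eq_iff Gam_cdf_estimator_def a_def)
    show "integrable M (Gam_cdf_estimator X n b x)"
      "integrable M (\<lambda>\<omega>. (Gam_cdf_estimator X n b x \<omega>)\<^sup>2)"
      "expectation (Gam_cdf_estimator X n b x) = kernel_mean b"
      "variance (Gam_cdf_estimator X n b x) = (kernel_sqmean b - (kernel_mean b)\<^sup>2) / real n"
      unfolding eq by (rule mean_of_iid_moments[OF indep Y \<open>n \<ge> 1\<close>]; assumption)+
  qed
  have decomp: "mse M (Gam_cdf_estimator X n b x) (F x) =
      variance (Gam_cdf_estimator X n b x) + (bias M (Gam_cdf_estimator X n b x) (F x))\<^sup>2"
    if "n \<ge> 1" "b > 0" for n b
    by (rule mse_eq_variance_plus_bias_squared) (rule est[OF that])+
  have mse_eq: "mse M (Gam_cdf_estimator X n b x) (F x) =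
      (kernel_sqmean b - (kernel_mean b)\<^sup>2) / real n + (kernel_mean b - F x)\<^sup>2"
    if "n \<ge> 1" "b > 0" for n b
    using decomp[OF that] est[OF that] by (simp add: bias_def)

  \<comment> \<open>Fixed before any bandwidth sequence is considered, as the order of quantifiers
    in the claim demands.\<close>
  obtain C where C: "\<And>b. 0 < b \<Longrightarrow> b \<le> 1 \<Longrightarrow>
      \<bar>kernel_sqmean b - (kernel_mean b)\<^sup>2 - (F x * (1 - F x) - sqrt b * A)\<bar> \<le> C * b"
    using kernel_variance_expansion unfolding A_def by blast

  \<comment> \<open>The expansion along a bandwidth sequence\<close>
  have expansion: "\<exists>R\<^sub>1 R\<^sub>2 :: nat \<Rightarrow> real.
      (\<forall>n\<ge>1. mse M (Gam_cdf_estimator X n (b n) x) (F x) =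
               Gam_amse F f f' x n (b n) + R\<^sub>1 n + R\<^sub>2 n) \<and>
      (\<forall>\<^sub>F n in sequentially. \<bar>R\<^sub>1 n\<bar> \<le> C * (1 / real n * b n)) \<and>
      R\<^sub>2 \<in> o(\<lambda>n. (b n)\<^sup>2)"
    if b: "\<And>n. n \<ge> 1 \<Longrightarrow> b n > 0" "b \<longlonglongrightarrow> 0" for b :: "nat \<Rightarrow> real"
  proof (intro exI conjI allI impI)
    \<comment> \<open>The variance error is put into \<open>R\<^sub>1\<close>, the squared-bias
      error into \<open>R\<^sub>2\<close>; no interaction term arises.\<close>
    define R\<^sub>1 where "R\<^sub>1 n = (kernel_sqmean (b n) - (kernel_mean (b n))\<^sup>2
      - (F x * (1 - F x) - sqrt (b n) * A)) / real n" for n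
    define R\<^sub>2 where "R\<^sub>2 n = (kernel_mean (b n) - F x)\<^sup>2 - (b n)\<^sup>2 * B" for n
    show "mse M (Gam_cdf_estimator X n (b n) x) (F x) = Gam_amse F f f' x n (b n) + R\<^sub>1 n + R\<^sub>2 n"
      if "n \<ge> 1" for n
      using that unfolding mse_eq[OF that b(1)[OF that]] Gam_amse_def A_def[symmetric] B_def[symmetric]
      by (simp add: R\<^sub>1_def R\<^sub>2_def field_simps)
    have pos: "\<forall>\<^sub>F n in sequentially. b n > 0"
      by (rule eventually_mono[OF eventually_ge_at_top[of 1]]) (rule b(1))
    \<comment> \<open>The variance estimate holds for bandwidths up to 1, so the bound on
      \<open>R\<^sub>1\<close> is an eventual one.\<close>
    have "\<forall>\<^sub>F n in sequentially. b n < 1"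
      using b(2) by (rule order_tendstoD) simp
    then show "\<forall>\<^sub>F n in sequentially. \<bar>R\<^sub>1 n\<bar> \<le> C * (1 / real n * b n)"
      using pos eventually_gt_at_top[of 0]
    proof eventually_elim
      case (elim n)
      then show ?case
        using C[of "b n"] by (simp add: R\<^sub>1_def abs_divide divide_right_mono)
    qed
    have "filterlim b (at_right 0) sequentially"
      using b(2) pos by (rule tendsto_imp_filterlim_at_right)
    then show "R\<^sub>2 \<in> o(\<lambda>n. (b n)\<^sup>2)"
      unfolding R\<^sub>2_def B_def by (rule landau_o.small.compose[OF kernel_square_bias_expansion])
  qed

  \<comment> \<open>Monotonicity of \<open>F\<close> gives \<open>f x >= 0\<close>, so the
    nonvanishing product forces \<open>f x > 0\<close>. Positivity of \<open>A\<close> and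
    \<open>B\<close> is what makes the critical bandwidth exist and be positive.\<close>
  have AB: "A > 0" "B > 0" if "f x * (f x + x / 2 * f' x) \<noteq> 0"
  proof -
    have "(F has_real_derivative f x) (at x)"
      using assms(5)[of x] at_within_interior[of x "{0..}"] \<open>x > 0\<close> by simp
    then have "f x \<ge> 0"
      using F_mono by (intro mono_on_imp_deriv_nonneg[of UNIV F]) auto
    with that \<open>x > 0\<close> show "A > 0" "B > 0"
      by (auto simp: A_def B_def)
  qed

  show ?thesis
  proof (intro conjI exI[of _ C] allI impI, goal_cases)
    case (1 b n)
    then show ?case
      using decomp by auto
  next
    case (2 b)
    then show ?case
      using expansion[of b] by auto
  next
    case (3 n b)
    have "Gam_amse F f f' x n
        = (\<lambda>b. 1 / real n * (F x * (1 - F x)) - 1 / real n * sqrt b * A + b\<^sup>2 * B)"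
      by (simp add: fun_eq_iff Gam_amse_def A_def B_def)
    then show ?case
      using sqrt_quadratic_unique_minimizer(1)[of A B "real n"] AB[OF 3(1)] 3(2)
      by (simp add: Gam_bopt_def A_def B_def)
  next
    case 4
    define k where "k = (4 * B / A) powr (- 2 / 3)"
    define b where "b = Gam_bopt f f' x"
    have b_eq: "b n = real n powr (- 2 / 3) * k" for n
      by (simp add: b_def Gam_bopt_def k_def A_def B_def)
    have k: "k > 0"
      using AB[OF 4] by (simp add: k_def)
    have "b \<longlonglongrightarrow> 0"
      unfolding b_eq[abs_def] by real_asymp
    \<comment> \<open>At \<open>n = 0\<close> the formula yields
      \<open>0 powr (- 2 / 3) = 0\<close>, so positivity starts at \<open>n = 1\<close>.\<close>
    moreover have b_pos: "b n > 0" if "n \<ge> 1" for n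
      using that k by (simp add: b_eq)
    ultimately obtain R\<^sub>1 R\<^sub>2 where
      mse: "\<And>n. n \<ge> 1 \<Longrightarrow> mse M (Gam_cdf_estimator X n (b n) x) (F x)
        = Gam_amse F f f' x n (b n) + R\<^sub>1 n + R\<^sub>2 n"
      and R1: "\<forall>\<^sub>F n in sequentially. \<bar>R\<^sub>1 n\<bar> \<le> C * (1 / real n * b n)"
      and R2: "R\<^sub>2 \<in> o(\<lambda>n. (b n)\<^sup>2)"
      using expansion[of b] by blast
    have "R\<^sub>1 \<in> O(\<lambda>n. 1 / real n * b n)"
    proof (rule bigoI[of _ C])
      show "\<forall>\<^sub>F n in sequentially. norm (R\<^sub>1 n) \<le> C * norm (1 / real n * b n)"
        using R1 eventually_ge_at_top[of 1]
        by eventually_elim (use b_pos in \<open>simp add: less_imp_le\<close>)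
    qed
    \<comment> \<open>With b of order n^(-2/3), the variance error is of order n^(-5/3), while b^2
      is exactly of order n^(-4/3), so the two error terms both fall below n^(-4/3).\<close>
    also have "(\<lambda>n. 1 / real n * b n) \<in> o(\<lambda>n. real n powr (- 4 / 3))"
      unfolding b_eq using k by real_asymp
    finally have "R\<^sub>1 \<in> o(\<lambda>n. real n powr (- 4 / 3))" .
    moreover have "(\<lambda>n. (b n)\<^sup>2) \<in> O(\<lambda>n. real n powr (- 4 / 3))"
      unfolding b_eq using k by real_asymp
    with R2 have "R\<^sub>2 \<in> o(\<lambda>n. real n powr (- 4 / 3))"
      by (rule landau_o.small_big_trans)
    ultimately have "(\<lambda>n. R\<^sub>1 n + R\<^sub>2 n) \<in> o(\<lambda>n. real n powr (- 4 / 3))"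
      by (rule sum_in_smallo)
    moreover have "\<forall>\<^sub>F n in sequentially. R\<^sub>1 n + R\<^sub>2 n = mse M (Gam_cdf_estimator X n (b n) x) (F x)
        - (1 / real n * (F x * (1 - F x))
          - real n powr (- 4 / 3) * (3 / 4) * (A ^ 4 / (4 * B)) powr (1 / 3))"
      using eventually_ge_at_top[of 1]
    proof eventually_elim
      case (elim n)
      have "Gam_amse F f f' x n (b n) = 1 / real n * (F x * (1 - F x))
          - real n powr (- 4 / 3) * (3 / 4) * (A ^ 4 / (4 * B)) powr (1 / 3)"
        using sqrt_quadratic_unique_minimizer(2)[of A B "real n" "1 / real n * (F x * (1 - F x))"]
          AB[OF 4] elim
        unfolding Gam_amse_def A_def[symmetric] B_def[symmetric] b_eq k_def by simp
      then show ?case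
        using mse[OF elim] by simp
    qed
    ultimately show ?case
      unfolding A_def[symmetric] B_def[symmetric] b_def[symmetric]
      by (subst (asm) landau_o.small.in_cong) auto
  qed
qed

end
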